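(* Let $M^{m+1}$ be a Riemannian manifold and let $\Sigma^m\subset M^{m+1}$ be an orientable hypersurface with unit normal vector field $\xi$. Then $\Sigma^m$ is totally umbilical if and only if $\xi$ minimizes rotation along every regular curve $\alpha:I\to\Sigma^m$. In addition, when this is the case, for every regular curve $\alpha:I\to \Sigma^m$ (parametrized by arc-length $s$) and every rotation minimizing frame $\{\alpha',\mathbf{n}_1,\dots,\mathbf{n}_m\}$ along $\alpha$ with curvatures $\kappa_1,\dots,\kappa_m$, writing $\xi(\alpha(s))=\sum_{i=1}^m a_i\mathbf{n}_i(s)$, the coefficients $a_1,\dots,a_m$ are constants and $$\sum_{i=1}^m a_i\kappa_i(s)=H(\alpha(s)),$$ where $H$ is the mean curvature of $\Sigma^m$.
   Context: $M^{m+1}$ is an $(m+1)$-dimensional Riemannian manifold (of class at least $C^3$) with metric $\langle\cdot,\cdot\rangle$ and Levi-Civita connection $\nabla$. Curves are of class $C^2$, regular, and parametrized by arc-length $s$, so $\langle\alpha',\alpha'\rangle=1$. A unit vector field $\mathbf{x}$ along $\alpha$, normal to $\alpha'$, is rotation minimizing (RM) along $\alpha$ (or "minimizes rotation along $\alpha$") if $\nabla_{\alpha'}\mathbf{x}=\lambda\,\alpha'$ for some function $\lambda$. An RM frame along $\alpha$ is an orthonormal frame $\{\alpha',\mathbf{n}_1,\dots,\mathbf{n}_m\}$ along $\alpha$ with each $\mathbf{n}_i$ RM; its curvatures $\kappa_i$ are defined by $\nabla_{\alpha'}\alpha'=\sum_{i=1}^m\kappa_i\mathbf{n}_i$ and $\nabla_{\alpha'}\mathbf{n}_i=-\kappa_i\alpha'$.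 The shape operator of $\Sigma$ is $S_p(X)=-(\nabla_X\xi)(p)$, $X\in T_p\Sigma$; its eigenvalues $\lambda_1,\dots,\lambda_m$ are the principal curvatures, and $H=\frac1m(\lambda_1+\dots+\lambda_m)$. A point $p\in\Sigma$ is umbilical if every unit vector in $T_p\Sigma$ is an eigenvector of $S_p$; $\Sigma$ is totally umbilical if all of its points are umbilical. *)

theory Defs
  imports "HOL-Analysis.Analysis"
begin

section \<open>Functions of class \<open>C\<^sup>k\<close>\<close>

text \<open>
  Only used for sets on which the derivative within the set is unique: open subsets of a
  Euclidean space, and relatively open subsets of a nondegenerate real interval (where the
  derivative is one-sided at an endpoint belonging to the interval).
\<close>

primrec Ck_on :: "nat \<Rightarrow> ('a::real_normed_vector \<Rightarrow> 'b::real_normed_vector) \<Rightarrow> 'a set \<Rightarrow> bool" where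
  "Ck_on 0 f S \<longleftrightarrow> continuous_on S f"
| "Ck_on (Suc k) f S \<longleftrightarrow> f differentiable_on S \<and>
     (\<forall>v. Ck_on k (\<lambda>x. frechet_derivative f (at x within S) v) S)"


section \<open>Charts and Riemannian manifolds\<close>

type_synonym ('a, 'e) chart = "'a set \<times> ('a \<Rightarrow> 'e)"

abbreviation cdom :: "('a, 'e) chart \<Rightarrow> 'a set" where "cdom c \<equiv> fst c"
abbreviation cmap :: "('a, 'e) chart \<Rightarrow> 'a \<Rightarrow> 'e" where "cmap c \<equiv> snd c"

definition cinv :: "('a, 'e) chart \<Rightarrow> 'e \<Rightarrow> 'a" where
  "cinv c = inv_into (cdom c) (cmap c)"

definition is_chart :: "'a topology \<Rightarrow> ('a, 'e::euclidean_space) chart \<Rightarrow> bool" where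
  "is_chart X c \<longleftrightarrow> openin X (cdom c) \<and> open (cmap c ` cdom c) \<and>
     homeomorphic_map (subtopology X (cdom c)) (top_of_set (cmap c ` cdom c)) (cmap c)"

definition transition :: "('a, 'e) chart \<Rightarrow> ('a, 'e) chart \<Rightarrow> 'e \<Rightarrow> 'e" where
  "transition c d = cmap d \<circ> cinv c"

definition Ck_compatible ::
    "nat \<Rightarrow> ('a, 'e::euclidean_space) chart \<Rightarrow> ('a, 'e) chart \<Rightarrow> bool" where
  "Ck_compatible k c d \<longleftrightarrow>
     Ck_on k (transition c d) (cmap c ` (cdom c \<inter> cdom d)) \<and>
     Ck_on k (transition d c) (cmap d ` (cdom c \<inter> cdom d))"

text \<open>
  The manifold is modelled on the Euclidean space \<open>'e\<close>, so its dimension is \<open>DIM('e)\<close>.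
  Each point \<open>p\<close> of the manifold is assigned a preferred chart \<open>chart_at M p\<close> of the atlas, and
  the tangent space at \<open>p\<close> is \<open>'e\<close>: a vector \<open>v :: 'e\<close> stands for the tangent vector at \<open>p\<close> whose
  components in \<open>chart_at M p\<close> are \<open>v\<close>. Its components in any other chart are obtained by
  applying the differential of the transition map. The field \<open>riem\<close> gives the inner product
  \<open>riem M p\<close> on the tangent space at \<open>p\<close>.
\<close>

record ('a, 'e) riemannian =
  pts :: "'a topology"
  atlas :: "('a, 'e) chart set"
  riem :: "'a \<Rightarrow> 'e \<Rightarrow> 'e \<Rightarrow> real"

definition chart_at :: "('a, 'e) riemannian \<Rightarrow> 'a \<Rightarrow> ('a, 'e) chart" where
  "chart_at M p = (SOME c. c \<in> atlas M \<and> p \<in> cdom c)"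

definition to_chart ::
    "('a, 'e::euclidean_space) riemannian \<Rightarrow> ('a, 'e) chart \<Rightarrow> 'a \<Rightarrow> 'e \<Rightarrow> 'e" where
  "to_chart M c p v =
     frechet_derivative (transition (chart_at M p) c) (at (cmap (chart_at M p) p)) v"

definition from_chart ::
    "('a, 'e::euclidean_space) riemannian \<Rightarrow> ('a, 'e) chart \<Rightarrow> 'a \<Rightarrow> 'e \<Rightarrow> 'e" where
  "from_chart M c p u =
     frechet_derivative (transition c (chart_at M p)) (at (cmap c p)) u"

text \<open>The metric in the chart \<open>c\<close>, at the coordinate point \<open>x\<close>.\<close>

definition riem_in ::
    "('a, 'e::euclidean_space) riemannian \<Rightarrow> ('a, 'e) chart \<Rightarrow> 'e \<Rightarrow> 'e \<Rightarrow> 'e \<Rightarrow> real" where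
  "riem_in M c x u v =
     riem M (cinv c x) (from_chart M c (cinv c x) u) (from_chart M c (cinv c x) v)"

text \<open>
  The metric is of class \<open>C\<^sup>2\<close>, the highest class that the transition maps of a \<open>C\<^sup>3\<close> atlas preserve
  for the components of a tensor field.
\<close>

definition riemannian_manifold :: "('a, 'e::euclidean_space) riemannian \<Rightarrow> bool" where
  "riemannian_manifold M \<longleftrightarrow>
     Hausdorff_space (pts M) \<and> second_countable (pts M) \<and>
     (\<forall>c\<in>atlas M. is_chart (pts M) c) \<and>
     (\<Union>c\<in>atlas M. cdom c) = topspace (pts M) \<and>
     (\<forall>c\<in>atlas M. \<forall>d\<in>atlas M. Ck_compatible 3 c d) \<and>
     (\<forall>p\<in>topspace (pts M). bilinear (riem M p) \<and>
        (\<forall>u v. riem M p u v = riem M p v u) \<and>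
        (\<forall>v. v \<noteq> 0 \<longrightarrow> riem M p v v > 0)) \<and>
     (\<forall>c\<in>atlas M. \<forall>u v. Ck_on 2 (\<lambda>x. riem_in M c x u v) (cmap c ` cdom c))"


section \<open>The Levi-Civita connection\<close>

text \<open>
  \<open>christoffel M c x u v\<close> is the vector whose \<open>k\<close>-th component is the sum of
  \<open>\<Gamma>\<^sup>k\<^sub>i\<^sub>j u\<^sub>i v\<^sub>j\<close> over \<open>i\<close> and \<open>j\<close>. It is given by the Koszul formula for the fields
  with constant components in \<open>c\<close>, whose Lie brackets vanish.
\<close>

definition christoffel ::
    "('a, 'e::euclidean_space) riemannian \<Rightarrow> ('a, 'e) chart \<Rightarrow> 'e \<Rightarrow> 'e \<Rightarrow> 'e \<Rightarrow> 'e" where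
  "christoffel M c x u v = (THE z. \<forall>w.
     2 * riem_in M c x z w =
       frechet_derivative (\<lambda>y. riem_in M c y v w) (at x) u +
       frechet_derivative (\<lambda>y. riem_in M c y u w) (at x) v -
       frechet_derivative (\<lambda>y. riem_in M c y u v) (at x) w)"

definition Ck_field ::
    "nat \<Rightarrow> ('a, 'e::euclidean_space) riemannian \<Rightarrow> 'a set \<Rightarrow> ('a \<Rightarrow> 'e) \<Rightarrow> bool" where
  "Ck_field k M W F \<longleftrightarrow> (\<forall>c\<in>atlas M.
     Ck_on k (\<lambda>x. to_chart M c (cinv c x) (F (cinv c x))) (cmap c ` (W \<inter> cdom c)))"

text \<open>
  The covariant derivative at \<open>p\<close> is computed in \<open>chart_at M p\<close>, whose components at \<open>p\<close> are by
  convention the tangent vectors at \<open>p\<close> themselves.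
\<close>

definition nabla ::
    "('a, 'e::euclidean_space) riemannian \<Rightarrow> ('a \<Rightarrow> 'e) \<Rightarrow> 'a \<Rightarrow> 'e \<Rightarrow> 'e" where
  "nabla M F p v = (let c = chart_at M p in
     frechet_derivative (\<lambda>x. to_chart M c (cinv c x) (F (cinv c x))) (at (cmap c p)) v +
     christoffel M c (cmap c p) v (F p))"


section \<open>Curves and rotation minimizing frames\<close>

definition Ck_curve ::
    "nat \<Rightarrow> ('a, 'e::euclidean_space) riemannian \<Rightarrow> real set \<Rightarrow> (real \<Rightarrow> 'a) \<Rightarrow> bool" where
  "Ck_curve k M I \<alpha> \<longleftrightarrow> is_interval I \<and> interior I \<noteq> {} \<and>
     continuous_map (top_of_set I) (pts M) \<alpha> \<and>
     (\<forall>c\<in>atlas M. Ck_on k (cmap c \<circ> \<alpha>) {t\<in>I. \<alpha> t \<in> cdom c})"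

definition velocity ::
    "('a, 'e::euclidean_space) riemannian \<Rightarrow> real set \<Rightarrow> (real \<Rightarrow> 'a) \<Rightarrow> real \<Rightarrow> 'e" where
  "velocity M I \<alpha> t = vector_derivative (cmap (chart_at M (\<alpha> t)) \<circ> \<alpha>) (at t within I)"

text \<open>Regular curves of class \<open>C\<^sup>2\<close> parametrized by arc-length.\<close>

definition arclength_curve ::
    "('a, 'e::euclidean_space) riemannian \<Rightarrow> real set \<Rightarrow> (real \<Rightarrow> 'a) \<Rightarrow> bool" where
  "arclength_curve M I \<alpha> \<longleftrightarrow> Ck_curve 2 M I \<alpha> \<and>
     (\<forall>s\<in>I. riem M (\<alpha> s) (velocity M I \<alpha> s) (velocity M I \<alpha> s) = 1)"

definition Ck_field_along ::
    "nat \<Rightarrow> ('a, 'e::euclidean_space) riemannian \<Rightarrow> real set \<Rightarrow> (real \<Rightarrow> 'a) \<Rightarrow> (real \<Rightarrow> 'e) \<Rightarrow> bool" where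
  "Ck_field_along k M I \<alpha> X \<longleftrightarrow> (\<forall>c\<in>atlas M.
     Ck_on k (\<lambda>t. to_chart M c (\<alpha> t) (X t)) {t\<in>I. \<alpha> t \<in> cdom c})"

definition cov_deriv ::
    "('a, 'e::euclidean_space) riemannian \<Rightarrow> real set \<Rightarrow> (real \<Rightarrow> 'a) \<Rightarrow> (real \<Rightarrow> 'e) \<Rightarrow> real \<Rightarrow> 'e" where
  "cov_deriv M I \<alpha> X t = (let c = chart_at M (\<alpha> t) in
     vector_derivative (\<lambda>\<tau>. to_chart M c (\<alpha> \<tau>) (X \<tau>)) (at t within I) +
     christoffel M c (cmap c (\<alpha> t)) (velocity M I \<alpha> t) (X t))"

definition rotation_minimizing ::
    "('a, 'e::euclidean_space) riemannian \<Rightarrow> real set \<Rightarrow> (real \<Rightarrow> 'a) \<Rightarrow> (real \<Rightarrow> 'e) \<Rightarrow> bool" where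
  "rotation_minimizing M I \<alpha> X \<longleftrightarrow> Ck_field_along 1 M I \<alpha> X \<and>
     (\<forall>s\<in>I. riem M (\<alpha> s) (X s) (X s) = 1 \<and> riem M (\<alpha> s) (X s) (velocity M I \<alpha> s) = 0) \<and>
     (\<exists>\<mu>::real \<Rightarrow> real. \<forall>s\<in>I. cov_deriv M I \<alpha> X s = \<mu> s *\<^sub>R velocity M I \<alpha> s)"

text \<open>
  \<open>{\<alpha>', n 1, \<dots>, n m}\<close> for \<open>m = DIM('e) - 1\<close>; that the \<open>n i\<close> are unit vectors orthogonal to the
  velocity is part of \<open>rotation_minimizing\<close>.
\<close>

definition rm_frame ::
    "('a, 'e::euclidean_space) riemannian \<Rightarrow> real set \<Rightarrow> (real \<Rightarrow> 'a) \<Rightarrow> (nat \<Rightarrow> real \<Rightarrow> 'e) \<Rightarrow> bool" where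
  "rm_frame M I \<alpha> n \<longleftrightarrow>
     (\<forall>i\<in>{1..DIM('e) - 1}. rotation_minimizing M I \<alpha> (n i)) \<and>
     (\<forall>i\<in>{1..DIM('e) - 1}. \<forall>j\<in>{1..DIM('e) - 1}. i \<noteq> j \<longrightarrow>
        (\<forall>s\<in>I. riem M (\<alpha> s) (n i s) (n j s) = 0))"

definition rm_curvatures ::
    "('a, 'e::euclidean_space) riemannian \<Rightarrow> real set \<Rightarrow> (real \<Rightarrow> 'a) \<Rightarrow> (nat \<Rightarrow> real \<Rightarrow> 'e) \<Rightarrow>
      (nat \<Rightarrow> real \<Rightarrow> real) \<Rightarrow> bool" where
  "rm_curvatures M I \<alpha> n \<kappa> \<longleftrightarrow> (\<forall>s\<in>I.
     cov_deriv M I \<alpha> (velocity M I \<alpha>) s = (\<Sum>i=1..DIM('e) - 1. \<kappa> i s *\<^sub>R n i s) \<and>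
     (\<forall>i\<in>{1..DIM('e) - 1}. cov_deriv M I \<alpha> (n i) s = - \<kappa> i s *\<^sub>R velocity M I \<alpha> s))"


section \<open>Hypersurfaces\<close>

text \<open>
  Embedded submanifolds of codimension one, of class \<open>C\<^sup>2\<close>: near each of its points the set is a
  linear hyperplane in suitable coordinates.
\<close>

definition hypersurface :: "('a, 'e::euclidean_space) riemannian \<Rightarrow> 'a set \<Rightarrow> bool" where
  "hypersurface M N \<longleftrightarrow> N \<subseteq> topspace (pts M) \<and>
     (\<forall>p\<in>N. \<exists>d b. is_chart (pts M) d \<and> p \<in> cdom d \<and> (\<forall>c\<in>atlas M. Ck_compatible 2 c d) \<and>
        b \<noteq> 0 \<and> cmap d ` (N \<inter> cdom d) = {x \<in> cmap d ` cdom d. b \<bullet> x = 0})"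

definition tangent_space ::
    "('a, 'e::euclidean_space) riemannian \<Rightarrow> 'a set \<Rightarrow> 'a \<Rightarrow> 'e set" where
  "tangent_space M N p = {velocity M I \<gamma> t | I \<gamma> t.
     Ck_curve 1 M I \<gamma> \<and> \<gamma> ` I \<subseteq> N \<and> t \<in> interior I \<and> \<gamma> t = p}"

definition local_extension ::
    "('a, 'e::euclidean_space) riemannian \<Rightarrow> 'a set \<Rightarrow> ('a \<Rightarrow> 'e) \<Rightarrow> 'a \<Rightarrow> ('a \<Rightarrow> 'e) \<Rightarrow> bool" where
  "local_extension M N \<xi> p F \<longleftrightarrow> (\<exists>W. openin (pts M) W \<and> p \<in> W \<and>
     Ck_field 1 M W F \<and> (\<forall>q\<in>N \<inter> W. F q = \<xi> q))"

text \<open>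
  A global unit normal field of class \<open>C\<^sup>1\<close>. An orientable hypersurface is understood as one that
  admits such a field; the ambient manifold itself need not be orientable.
\<close>

definition unit_normal_field ::
    "('a, 'e::euclidean_space) riemannian \<Rightarrow> 'a set \<Rightarrow> ('a \<Rightarrow> 'e) \<Rightarrow> bool" where
  "unit_normal_field M N \<xi> \<longleftrightarrow> (\<forall>p\<in>N. riem M p (\<xi> p) (\<xi> p) = 1 \<and>
     (\<forall>v\<in>tangent_space M N p. riem M p (\<xi> p) v = 0) \<and>
     (\<exists>F. local_extension M N \<xi> p F))"

text \<open>
  For \<open>v\<close> tangent to \<open>N\<close>, the covariant derivative does not depend on the extension of \<open>\<xi>\<close>.
\<close>

definition shape_operator ::
    "('a, 'e::euclidean_space) riemannian \<Rightarrow> 'a set \<Rightarrow> ('a \<Rightarrow> 'e) \<Rightarrow> 'a \<Rightarrow> 'e \<Rightarrow> 'e" where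
  "shape_operator M N \<xi> p v = - (THE y. \<exists>F. local_extension M N \<xi> p F \<and> y = nabla M F p v)"

definition principal_space ::
    "('a, 'e::euclidean_space) riemannian \<Rightarrow> 'a set \<Rightarrow> ('a \<Rightarrow> 'e) \<Rightarrow> 'a \<Rightarrow> real \<Rightarrow> 'e set" where
  "principal_space M N \<xi> p l = {v \<in> tangent_space M N p. shape_operator M N \<xi> p v = l *\<^sub>R v}"

definition principal_curvatures ::
    "('a, 'e::euclidean_space) riemannian \<Rightarrow> 'a set \<Rightarrow> ('a \<Rightarrow> 'e) \<Rightarrow> 'a \<Rightarrow> real set" where
  "principal_curvatures M N \<xi> p = {l. \<exists>v\<in>principal_space M N \<xi> p l. v \<noteq> 0}"

text \<open>
  The mean of the \<open>m = DIM('e) - 1\<close> principal curvatures, each counted with its multiplicity.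
\<close>

definition mean_curvature ::
    "('a, 'e::euclidean_space) riemannian \<Rightarrow> 'a set \<Rightarrow> ('a \<Rightarrow> 'e) \<Rightarrow> 'a \<Rightarrow> real" where
  "mean_curvature M N \<xi> p = (1 / real (DIM('e) - 1)) *
     (\<Sum>l\<in>principal_curvatures M N \<xi> p. real (dim (principal_space M N \<xi> p l)) * l)"

definition umbilical_at ::
    "('a, 'e::euclidean_space) riemannian \<Rightarrow> 'a set \<Rightarrow> ('a \<Rightarrow> 'e) \<Rightarrow> 'a \<Rightarrow> bool" where
  "umbilical_at M N \<xi> p \<longleftrightarrow> (\<forall>v\<in>tangent_space M N p. riem M p v v = 1 \<longrightarrow>
     (\<exists>l::real. shape_operator M N \<xi> p v = l *\<^sub>R v))"

definition totally_umbilical ::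
    "('a, 'e::euclidean_space) riemannian \<Rightarrow> 'a set \<Rightarrow> ('a \<Rightarrow> 'e) \<Rightarrow> bool" where
  "totally_umbilical M N \<xi> \<longleftrightarrow> (\<forall>p\<in>N. umbilical_at M N \<xi> p)"

end

theory Submission
  imports Defs
begin

text \<open>
  Along a curve \<open>\<alpha>\<close> in \<open>\<Sigma>\<close> the covariant derivative of \<open>\<xi> \<circ> \<alpha>\<close> is \<open>-S(\<alpha>')\<close>, so \<open>\<xi>\<close> minimizes rotation
  along \<open>\<alpha>\<close> iff \<open>\<alpha>'\<close> is at every point an eigenvector of the shape operator \<open>S\<close>. Every unit tangent
  vector is the velocity of an arc-length curve in \<open>\<Sigma>\<close>, namely of a reparametrized straight line in
  coordinates that flatten \<open>\<Sigma>\<close>; this gives the equivalence. If \<open>\<Sigma>\<close> is totally umbilical, then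
  \<open>S = H \<cdot> id\<close> on each tangent space. For an RM frame, \<open>a\<^sub>i = \<langle>\<xi>, n\<^sub>i\<rangle>\<close> has derivative
  \<open>\<langle>\<nabla>\<xi>, n\<^sub>i\<rangle> + \<langle>\<xi>, \<nabla>n\<^sub>i\<rangle> = 0\<close>, since both covariant derivatives are multiples of \<open>\<alpha>'\<close>. Differentiating
  \<open>\<xi> = \<Sum> a\<^sub>i n\<^sub>i\<close> with constant \<open>a\<^sub>i\<close> then gives \<open>-H \<alpha>' = -(\<Sum> a\<^sub>i \<kappa>\<^sub>i) \<alpha>'\<close>.
\<close>

text \<open>The encoding of tangent vectors shapes the argument. A vector at \<open>p\<close> is its
  component vector in \<open>chart_at M p\<close>, and this chart may jump from point to point, so a
  field or a velocity is not a function that can be differentiated directly. Derivatives are taken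
  in one chart kept fixed near the parameter in question. With the preferred chart of the point
  itself, \<open>to_chart\<close> is the identity there, and the derivative plus the Christoffel
  term is \<open>cov_deriv\<close> or \<open>nabla\<close>.

  Regularity is the second constraint. Flattening charts are only C^2 related to the atlas, so lines
  in them are C^2 curves with C^1 speed; the inverse of the arc-length function is then again C^2,
  as \<open>arclength_curve\<close> demands.

  Finally, \<open>tangent_space\<close> is a set of velocities at interior parameters, with no
  visible linear structure, while curves may live on intervals with endpoints. A flattening chart
  describes it as the kernel of one linear functional. This yields the subspace property, the
  dimension that enters the mean curvature, and tangency at endpoints.\<close>

section \<open>Calculus of \<open>C\<^sup>k\<close> functions\<close>

text \<open>This makes the derivative within \<open>S\<close> unique, which covers the two kinds of domains used:
  open sets and relatively open subsets of an interval.\<close>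

definition accessible :: "'a::euclidean_space set \<Rightarrow> bool" where
  "accessible S \<longleftrightarrow> (\<forall>x\<in>S. \<forall>i\<in>Basis. \<forall>e>0. \<exists>d. 0 < \<bar>d\<bar> \<and> \<bar>d\<bar> < e \<and> x + d *\<^sub>R i \<in> S)"

lemma accessible_frechet_derivative:
  assumes "accessible S" "x \<in> S" "(f has_derivative D) (at x within S)"
  shows "frechet_derivative f (at x within S) = D"
proof -
  have "(f has_derivative frechet_derivative f (at x within S)) (at x within S)"
    using assms(3) differentiableI frechet_derivative_works by blast
  then show ?thesis
    using assms frechet_derivative_unique_within[of f _ x S D] unfolding accessible_def by blast
qed

lemma open_accessible: "accessible S" if "open S"
  unfolding accessible_def
proof (intro ballI allI impI)
  fix x i :: 'a and e :: real assume "x \<in> S" "i \<in> Basis" "e > 0"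
  obtain r where "r > 0" "ball x r \<subseteq> S" using \<open>open S\<close> \<open>x \<in> S\<close> open_contains_ball by blast
  then show "\<exists>d. 0 < \<bar>d\<bar> \<and> \<bar>d\<bar> < e \<and> x + d *\<^sub>R i \<in> S"
    using \<open>i \<in> Basis\<close> \<open>e > 0\<close>
    by (intro exI[of _ "min e r / 2"]) (auto simp: subset_iff dist_norm)
qed

lemma openin_interval_accessible:
  fixes I S :: "real set"
  assumes "is_interval I" "interior I \<noteq> {}" "openin (top_of_set I) S"
  shows "accessible S"
  unfolding accessible_def
proof (intro ballI allI impI)
  fix x i e :: real assume x: "x \<in> S" and i: "i \<in> Basis" and e: "e > 0"
  obtain T where T: "open T" "S = I \<inter> T" using assms(3) by (auto simp: openin_open)
  obtain r where r: "r > 0" "ball x r \<subseteq> T" using T x open_contains_ball by blast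
  obtain y where y: "y \<in> I" "y \<noteq> x"
  proof -
    have "\<not> I \<subseteq> {x}" using interior_mono[of I "{x}"] assms(2) by auto
    then show ?thesis using that by blast
  qed
  \<comment> \<open>Moving from \<open>x\<close> towards \<open>y\<close> stays in the convex set
    \<open>I\<close> as long as the fraction \<open>m\<close> is at most 1; the second bound makes
    the displacement at most half of \<open>min e r\<close>, hence within both \<open>e\<close> and
    the ball inside \<open>T\<close>.\<close>
  define m where "m = min 1 (min e r / (2 * \<bar>y - x\<bar>))"
  have m: "0 < m" "m \<le> 1" "m * \<bar>y - x\<bar> \<le> min e r / 2"
    using e r y by (auto simp: m_def min_def field_simps)
  have "x + m * (y - x) \<in> I"
  proof -
    have "convex I" using assms(1) is_interval_convex by blast
    from convexD[OF this, of x y "1 - m" m] show ?thesis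
      using x y m T by (auto simp: algebra_simps)
  qed
  moreover have "\<bar>m * (y - x)\<bar> < min e r" using m e r by (simp add: abs_mult)
  then have "x + m * (y - x) \<in> T" using r by (auto simp: subset_iff dist_norm)
  ultimately show "\<exists>d. 0 < \<bar>d\<bar> \<and> \<bar>d\<bar> < e \<and> x + d *\<^sub>R i \<in> S"
    using i T y m \<open>\<bar>m * (y - x)\<bar> < min e r\<close> by (intro exI[of _ "m * (y - x)"]) auto
qed

lemma at_within_openin_eq:
  assumes "openin (top_of_set T) S" "x \<in> S"
  shows "at x within S = at x within T"
proof -
  obtain U where "open U" "S = T \<inter> U" using assms(1) by (auto simp: openin_open)
  then show ?thesis using assms(2) by (intro at_within_nhd[of x U]) auto
qed

lemma frechet_derivative_cong:
  assumes "x \<in> S" "\<And>y. y \<in> S \<Longrightarrow> f y = g y"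
  shows "frechet_derivative f (at x within S) = frechet_derivative g (at x within S)"
proof -
  have "(f has_derivative D) (at x within S) \<longleftrightarrow> (g has_derivative D) (at x within S)" for D
    using assms by (metis has_derivative_transform)
  then show ?thesis unfolding frechet_derivative_def by simp
qed

lemma Ck_on_cong:
  assumes "\<And>x. x \<in> S \<Longrightarrow> f x = g x" "Ck_on k f S"
  shows "Ck_on k g S"
  using assms
proof (induction k arbitrary: f g)
  case 0
  then show ?case by (simp cong: continuous_on_cong)
next
  case (Suc k)
  have D: "frechet_derivative f (at x within S) = frechet_derivative g (at x within S)"
    if "x \<in> S" for x using frechet_derivative_cong[OF that Suc.prems(1)] .
  have "g differentiable_on S"
    using Suc.prems unfolding Ck_on.simps differentiable_on_def differentiable_def
    by (metis has_derivative_transform)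
  moreover have "Ck_on k (\<lambda>x. frechet_derivative g (at x within S) v) S" for v
    by (rule Suc.IH[of "\<lambda>x. frechet_derivative f (at x within S) v"])
       (use Suc.prems(2) D in auto)
  ultimately show ?case by simp
qed

lemma Ck_on_openin:
  assumes "openin (top_of_set T) S" "Ck_on k f T"
  shows "Ck_on k f S"
  using assms(2)
proof (induction k arbitrary: f)
  case 0
  then show ?case using continuous_on_subset[OF _ openin_imp_subset[OF assms(1)]] by simp
next
  case (Suc k)
  have *: "at x within S = at x within T" if "x \<in> S" for x
    using at_within_openin_eq[OF assms(1) that] .
  have "f differentiable_on S"
    using Suc.prems openin_imp_subset[OF assms(1)] * by (auto simp: differentiable_on_def)
  moreover have "Ck_on k (\<lambda>x. frechet_derivative f (at x within S) v) S" for v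
    by (rule Ck_on_cong[OF _ Suc.IH[of "\<lambda>x. frechet_derivative f (at x within T) v"]])
       (use Suc.prems * in auto)
  ultimately show ?case by simp
qed

text \<open>Differentiation within a relatively open piece is differentiation within
  \<open>S\<close>. This allows a field to be checked piece by piece when its extensions exist only
  near each point.\<close>

lemma Ck_on_local:
  assumes "\<And>x. x \<in> S \<Longrightarrow> \<exists>T. x \<in> T \<and> openin (top_of_set S) T \<and> Ck_on k f T"
  shows "Ck_on k f S"
  using assms
proof (induction k arbitrary: f)
  case 0
  show ?case unfolding Ck_on.simps continuous_on_eq_continuous_within
  proof
    fix x assume "x \<in> S"
    then obtain T where T: "x \<in> T" "openin (top_of_set S) T" "continuous_on T f" using 0 by force
    then show "continuous (at x within S) f"
      using at_within_openin_eq[OF T(2,1)] by (auto simp: continuous_on_eq_continuous_within)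
  qed
next
  case (Suc k)
  have "f differentiable_on S" unfolding differentiable_on_def
  proof
    fix x assume "x \<in> S"
    then obtain T where T: "x \<in> T" "openin (top_of_set S) T" "Ck_on (Suc k) f T" using Suc.prems by blast
    then show "f differentiable (at x within S)"
      using at_within_openin_eq[OF T(2,1)] by (auto simp: differentiable_on_def)
  qed
  moreover have "Ck_on k (\<lambda>x. frechet_derivative f (at x within S) v) S" for v
  proof (rule Suc.IH)
    fix x assume "x \<in> S"
    then obtain T where T: "x \<in> T" "openin (top_of_set S) T" "Ck_on (Suc k) f T" using Suc.prems by blast
    have "Ck_on k (\<lambda>x. frechet_derivative f (at x within S) v) T"
      by (rule Ck_on_cong[of _ "\<lambda>x. frechet_derivative f (at x within T) v"])
         (use T at_within_openin_eq[OF T(2)] in auto)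
    then show "\<exists>T. x \<in> T \<and> openin (top_of_set S) T \<and>
       Ck_on k (\<lambda>x. frechet_derivative f (at x within S) v) T" using T by blast
  qed
  ultimately show ?case by simp
qed

text \<open>\<open>Ck_on\<close> is stated with \<open>frechet_derivative\<close>, a choice
  operator. Accessibility identifies it with any derivative computed by hand, so that the closure
  rules below become inductions using the usual differentiation rules.\<close>

lemma Ck_on_SucI:
  assumes "accessible S" "\<And>x. x \<in> S \<Longrightarrow> (f has_derivative D x) (at x within S)"
    and "\<And>v. Ck_on k (\<lambda>x. D x v) S"
  shows "Ck_on (Suc k) f S"
proof -
  have "Ck_on k (\<lambda>x. frechet_derivative f (at x within S) v) S" for v
    by (rule Ck_on_cong[OF _ assms(3)[of v]])
       (use accessible_frechet_derivative[OF assms(1) _ assms(2)] in auto)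
  then show ?thesis using assms(2) by (auto simp: differentiable_on_def differentiable_def)
qed

lemma Ck_on_SucE:
  assumes "Ck_on (Suc k) f S"
  obtains D where "\<And>x. x \<in> S \<Longrightarrow> (f has_derivative D x) (at x within S)"
    "\<And>v. Ck_on k (\<lambda>x. D x v) S"
  using assms that[of "\<lambda>x. frechet_derivative f (at x within S)"]
  by (auto simp: differentiable_on_def frechet_derivative_works)

lemma Ck_on_Suc_imp: "Ck_on (Suc k) f S \<Longrightarrow> Ck_on k f S"
  by (induction k arbitrary: f) (auto intro: differentiable_imp_continuous_on)

lemma Ck_on_mono: "Ck_on k f S" if "Ck_on l f S" "k \<le> l"
  using that(2,1)
proof (induction rule: dec_induct)
  case (step n)
  then show ?case using Ck_on_Suc_imp by blast
qed auto

lemma Ck_on_const: "accessible S \<Longrightarrow> Ck_on k (\<lambda>_. c) S"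
proof (induction k arbitrary: c)
  case (Suc k)
  show ?case by (rule Ck_on_SucI[where D = "\<lambda>_ _. 0"]) (use Suc in auto)
qed auto

lemma Ck_on_linear:
  assumes "accessible S" "bounded_linear L" "Ck_on k f S"
  shows "Ck_on k (\<lambda>x. L (f x)) S"
  using assms(3)
proof (induction k arbitrary: f)
  case 0
  then show ?case using linear_continuous_on[OF assms(2)]
    by (simp add: continuous_on_compose2[where s = UNIV] continuous_on_compose2 assms(2) bounded_linear.continuous_on)
next
  case (Suc k)
  obtain D where D: "\<And>x. x \<in> S \<Longrightarrow> (f has_derivative D x) (at x within S)"
    "\<And>v. Ck_on k (\<lambda>x. D x v) S" using Suc.prems Ck_on_SucE by blast
  show ?case
    by (rule Ck_on_SucI[OF assms(1) bounded_linear.has_derivative[OF assms(2) D(1)] Suc.IH[OF D(2)]])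
qed

lemma Ck_on_add:
  assumes "accessible S" "Ck_on k f S" "Ck_on k g S"
  shows "Ck_on k (\<lambda>x. f x + g x) S"
  using assms(2,3)
proof (induction k arbitrary: f g)
  case 0
  then show ?case by (auto intro: continuous_on_add)
next
  case (Suc k)
  obtain D where D: "\<And>x. x \<in> S \<Longrightarrow> (f has_derivative D x) (at x within S)"
    "\<And>v. Ck_on k (\<lambda>x. D x v) S" using Suc.prems Ck_on_SucE by blast
  obtain E where E: "\<And>x. x \<in> S \<Longrightarrow> (g has_derivative E x) (at x within S)"
    "\<And>v. Ck_on k (\<lambda>x. E x v) S" using Suc.prems Ck_on_SucE by blast
  show ?case
    by (rule Ck_on_SucI[OF assms(1) has_derivative_add[OF D(1) E(1)] Suc.IH[OF D(2) E(2)]])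
qed

lemma Ck_on_sum:
  assumes "accessible S" "\<And>i. i \<in> A \<Longrightarrow> Ck_on k (f i) S"
  shows "Ck_on k (\<lambda>x. \<Sum>i\<in>A. f i x) S"
  using assms(2)
  by (induction A rule: infinite_finite_induct)
     (auto intro: Ck_on_const[OF assms(1)] Ck_on_add[OF assms(1)])

lemma Ck_on_scaleR:
  assumes "accessible S" "Ck_on k f S" "Ck_on k g S"
  shows "Ck_on k (\<lambda>x. f x *\<^sub>R g x) S"
  using assms(2,3)
proof (induction k arbitrary: f g)
  case 0
  then show ?case by (auto intro: continuous_on_scaleR)
next
  case (Suc k)
  obtain D where D: "\<And>x. x \<in> S \<Longrightarrow> (f has_derivative D x) (at x within S)"
    "\<And>v. Ck_on k (\<lambda>x. D x v) S" using Suc.prems Ck_on_SucE by blast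
  obtain E where E: "\<And>x. x \<in> S \<Longrightarrow> (g has_derivative E x) (at x within S)"
    "\<And>v. Ck_on k (\<lambda>x. E x v) S" using Suc.prems Ck_on_SucE by blast
  show ?case
    by (rule Ck_on_SucI[OF assms(1) has_derivative_scaleR[OF D(1) E(1)]
          Ck_on_add[OF assms(1) Suc.IH[OF _ E(2)] Suc.IH[OF D(2)]]])
       (use Suc.prems Ck_on_Suc_imp in auto)
qed

lemma Ck_on_mult:
  fixes f g :: "'a::euclidean_space \<Rightarrow> real"
  assumes "accessible S" "Ck_on k f S" "Ck_on k g S"
  shows "Ck_on k (\<lambda>x. f x * g x) S"
  using Ck_on_scaleR[OF assms] by simp

lemma Ck_on_compose:
  fixes f :: "'b::euclidean_space \<Rightarrow> 'c::real_normed_vector" and g :: "'a::euclidean_space \<Rightarrow> 'b"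
  assumes "accessible S" "g ` S \<subseteq> T" "Ck_on k f T" "Ck_on k g S"
  shows "Ck_on k (\<lambda>x. f (g x)) S"
  using assms(3,4)
proof (induction k arbitrary: f)
  case 0
  then show ?case using assms(2) by (auto intro: continuous_on_compose2)
next
  case (Suc k)
  obtain D where D: "\<And>x. x \<in> T \<Longrightarrow> (f has_derivative D x) (at x within T)"
    "\<And>v. Ck_on k (\<lambda>x. D x v) T" using Suc.prems Ck_on_SucE by blast
  obtain E where E: "\<And>x. x \<in> S \<Longrightarrow> (g has_derivative E x) (at x within S)"
    "\<And>v. Ck_on k (\<lambda>x. E x v) S" using Suc.prems Ck_on_SucE by blast
  \<comment> \<open>In the chain rule \<open>D (g x) (E x v)\<close> the direction
    \<open>E x v\<close> moves with \<open>x\<close>, while the induction hypothesis handles only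
    fixed directions. Expanding it in the basis leaves products of C^k coefficients with
    \<open>D (g x) b\<close> for constant \<open>b\<close>.\<close>
  define F where "F x v = (\<Sum>b\<in>Basis. (E x v \<bullet> b) *\<^sub>R D (g x) b)" for x v
  have der: "((\<lambda>x. f (g x)) has_derivative F x) (at x within S)" if "x \<in> S" for x
  proof -
    have "((\<lambda>x. f (g x)) has_derivative (\<lambda>v. D (g x) (E x v))) (at x within S)"
      by (rule has_derivative_in_compose[OF E(1)[OF that] has_derivative_subset[OF D(1) assms(2)]])
         (use that assms(2) in auto)
    moreover have "linear (D (g x))" using D(1) that assms(2) has_derivative_linear by blast
    then have "(\<lambda>v. D (g x) (E x v)) = F x"
      unfolding F_def using linear_sum[of "D (g x)" "\<lambda>b. (E x v \<bullet> b) *\<^sub>R b" Basis for v]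
      by (simp add: euclidean_representation linear_scale)
    ultimately show ?thesis by simp
  qed
  have "Ck_on k (\<lambda>x. F x v) S" for v
    unfolding F_def
    by (rule Ck_on_sum[OF assms(1)], rule Ck_on_scaleR[OF assms(1)],
        rule Ck_on_linear[OF assms(1) bounded_linear_inner_left E(2)],
        rule Suc.IH[OF D(2) Ck_on_Suc_imp[OF Suc.prems(2)]])
  from Ck_on_SucI[OF assms(1) der this] show ?case .
qed

section \<open>Fields of inner products and their Christoffel symbols\<close>

lemma bilinear_expand:
  fixes B :: "'e::euclidean_space \<Rightarrow> 'e \<Rightarrow> real"
  assumes "bilinear B"
  shows "B u v = (\<Sum>i\<in>Basis. \<Sum>j\<in>Basis. (u \<bullet> i) * (v \<bullet> j) * B i j)"
proof -
  have l: "linear (\<lambda>x. B x y)" and r: "linear (\<lambda>y. B x y)" for x y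
    using assms by (auto simp: bilinear_def)
  have 1: "B u v = (\<Sum>i\<in>Basis. (u \<bullet> i) * B i v)"
    using linear_sum[OF l[of v], of "\<lambda>b. (u \<bullet> b) *\<^sub>R b" Basis]
    by (simp add: euclidean_representation linear_scale[OF l])
  have 2: "B i v = (\<Sum>j\<in>Basis. (v \<bullet> j) * B i j)" for i
    using linear_sum[OF r[of i], of "\<lambda>b. (v \<bullet> b) *\<^sub>R b" Basis]
    by (simp add: euclidean_representation linear_scale[OF r])
  show ?thesis by (simp only: 1) (simp add: 2 sum_distrib_left mult.assoc)
qed

locale inner_form =
  fixes g :: "'e::euclidean_space \<Rightarrow> 'e \<Rightarrow> real"
  assumes bil: "bilinear g"
    and sym: "g u v = g v u"
    and pos: "v \<noteq> 0 \<Longrightarrow> g v v > 0"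
begin

lemma linear_left: "linear (\<lambda>u. g u v)" and linear_right: "linear (g u)"
  using bil by (auto simp: bilinear_def)

lemmas form_simps = linear_add[OF linear_left] linear_add[OF linear_right]
  linear_diff[OF linear_left] linear_diff[OF linear_right]
  linear_scale[OF linear_left] linear_scale[OF linear_right]
  linear_0[OF linear_left] linear_0[OF linear_right]
  linear_neg[OF linear_left] linear_neg[OF linear_right]

lemmas form_sum = linear_sum[OF linear_left] linear_sum[OF linear_right]

lemma form_eqI: "z = z'" if "\<And>w. g z w = g z' w"
proof -
  have "g (z - z') (z - z') = 0" using that by (simp add: form_simps)
  then show ?thesis using pos[of "z - z'"] by fastforce
qed

text \<open>Riesz representation for \<open>g\<close>. The map \<open>T\<close> encodes the
  functional \<open>g z\<close> by its values on the basis; positivity makes it injective, and a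
  linear injection of a finite-dimensional space into itself is onto.\<close>

lemma representer:
  assumes "linear \<phi>"
  shows "\<exists>z. \<forall>w. g z w = \<phi> w"
proof -
  define T where "T z = (\<Sum>b\<in>Basis. g z b *\<^sub>R b)" for z
  have Tb: "T z \<bullet> b = g z b" if "b \<in> Basis" for z b
    using that unfolding T_def by (simp add: inner_sum_left_Basis)
  have exp: "f w = (\<Sum>b\<in>Basis. (w \<bullet> b) * f b)" if "linear f" for f :: "'e \<Rightarrow> real" and w
    using linear_sum[OF that, of "\<lambda>b. (w \<bullet> b) *\<^sub>R b" Basis]
    by (simp add: euclidean_representation linear_scale[OF that])
  have lin: "linear T"
    unfolding T_def
    by (rule linearI) (simp_all add: form_simps scaleR_add_left sum.distrib scaleR_sum_right)
  have "inj T"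
  proof (rule linear_injective_0[OF lin, THEN iffD2], intro allI impI)
    fix z assume "T z = 0"
    then have "g z b = 0" if "b \<in> Basis" for b using Tb[OF that, of z] by simp
    then have "g z z = 0" using exp[OF linear_right, of z z] by simp
    then show "z = 0" using pos by fastforce
  qed
  then have "surj T" using lin linear_injective_imp_surjective by blast
  then obtain z where z: "T z = (\<Sum>b\<in>Basis. \<phi> b *\<^sub>R b)" by (metis surjD)
  have "g z b = \<phi> b" if "b \<in> Basis" for b
    using Tb[OF that, of z] that by (simp add: z inner_sum_left_Basis)
  then have "g z w = \<phi> w" for w
    using exp[OF linear_right, of z w] exp[OF assms, of w] by simp
  then show ?thesis by blast
qed

text \<open>Positivity together with orthogonality of distinct indices forces \<open>f\<close> to be
  injective, so the bound on independent sets counts indices. It later shows that a rotation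
  minimizing frame leaves no room for a further direction.\<close>

lemma orthogonal_card_le:
  assumes "finite J" "\<And>i. i \<in> J \<Longrightarrow> f i \<noteq> 0"
    and "\<And>i j. i \<in> J \<Longrightarrow> j \<in> J \<Longrightarrow> i \<noteq> j \<Longrightarrow> g (f i) (f j) = 0"
  shows "card J \<le> DIM('e)"
proof -
  have inj: "inj_on f J"
    by (rule inj_onI) (metis assms(2,3) pos less_irrefl)
  have "independent (f ` J)"
  proof (rule independent_if_scalars_zero)
    show "finite (f ` J)" using assms(1) by simp
    fix c x assume 0: "(\<Sum>x\<in>f ` J. c x *\<^sub>R x) = 0" and "x \<in> f ` J"
    then obtain i where i: "i \<in> J" "x = f i" by blast
    have "0 = g (\<Sum>j\<in>J. c (f j) *\<^sub>R f j) (f i)"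
      using 0 by (simp add: sum.reindex[OF inj] form_simps)
    also have "\<dots> = (\<Sum>j\<in>J. c (f j) * g (f j) (f i))"
      by (simp add: form_sum form_simps)
    also have "\<dots> = (\<Sum>j\<in>J. if j = i then c (f i) * g (f i) (f i) else 0)"
      using assms(3) i by (intro sum.cong) auto
    also have "\<dots> = c (f i) * g (f i) (f i)" using assms(1) i by simp
    finally show "c x = 0" using pos[OF assms(2)[OF i(1)]] i by simp
  qed
  then have "card (f ` J) \<le> DIM('e)" using independent_bound by blast
  then show ?thesis using card_image[OF inj] by simp
qed

end

text \<open>The metric as seen in a single chart, detached from the manifold: the coordinate
  computations with Christoffel symbols take place here.\<close>

locale metric_field =
  fixes g :: "'e::euclidean_space \<Rightarrow> 'e \<Rightarrow> 'e \<Rightarrow> real" and U :: "'e set"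
  assumes open_U: "open U"
    and form: "x \<in> U \<Longrightarrow> inner_form (g x)"
    and diff: "x \<in> U \<Longrightarrow> (\<lambda>y. g y u v) differentiable (at x)"
begin

text \<open>The last argument is the direction of differentiation; \<open>u\<close> and
  \<open>v\<close> are vectors with constant components.\<close>

definition dg :: "'e \<Rightarrow> 'e \<Rightarrow> 'e \<Rightarrow> 'e \<Rightarrow> real" where
  "dg x u v = frechet_derivative (\<lambda>y. g y u v) (at x)"

definition \<Gamma> :: "'e \<Rightarrow> 'e \<Rightarrow> 'e \<Rightarrow> 'e" where
  "\<Gamma> x u v = (THE z. \<forall>w. 2 * g x z w = dg x v w u + dg x u w v - dg x u v w)"

lemma has_derivative_dg: "x \<in> U \<Longrightarrow> ((\<lambda>y. g y u v) has_derivative dg x u v) (at x)"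
  unfolding dg_def using diff frechet_derivative_works by blast

lemma dg_eqI:
  assumes "x \<in> U" "(f has_derivative D) (at x)" "\<And>y. y \<in> U \<Longrightarrow> f y = g y u v"
  shows "dg x u v = D"
  using has_derivative_unique[OF has_derivative_dg[OF assms(1)]
      has_derivative_transform_within_open[OF assms(2) open_U assms(1,3)]] .

lemma dg_sym: "x \<in> U \<Longrightarrow> dg x u v w = dg x v u w"
  using dg_eqI[OF _ has_derivative_dg, of x u v v u] form inner_form.sym by metis

lemma dg_bilinear: "bilinear (\<lambda>u v. dg x u v w)" if x: "x \<in> U"
proof -
  \<comment> \<open>One identity serves for additivity (\<open>a = 1\<close>) and homogeneity
    (\<open>u' = 0\<close>). The latter needs the value at 0, obtained from the same identity with
    \<open>a = 1\<close> and both vectors zero, which says that the value equals its double.\<close>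
  have gx: "g y (a *\<^sub>R u + u') v = a * g y u v + g y u' v" if "y \<in> U" for y a u u' v
    using inner_form.form_simps[OF form[OF that]] by simp
  have "dg x (a *\<^sub>R u + u') v = (\<lambda>w. a * dg x u v w + dg x u' v w)" for a u u' v
    by (rule dg_eqI[OF x has_derivative_add[OF has_derivative_mult_right[OF has_derivative_dg[OF x]]
          has_derivative_dg[OF x]]])
       (simp add: gx)
  then have l: "dg x (a *\<^sub>R u + u') v w = a * dg x u v w + dg x u' v w" for a u u' v w by metis
  have z: "dg x 0 v w = 0" for v w using l[of 1 0 0 v w] by simp
  have "linear (\<lambda>u. dg x u v w)" for v w
    by (rule linearI) (use l[of 1] l[of _ _ 0] z in auto)
  moreover from this have "linear (\<lambda>v. dg x u v w)" for u
    using dg_sym[OF x, of u _ w] by simp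
  ultimately show ?thesis by (simp add: bilinear_def)
qed

lemma dg_linear: "x \<in> U \<Longrightarrow> linear (dg x u v)"
  by (rule has_derivative_linear[OF has_derivative_dg])

lemmas dg_simps =
  linear_add[OF dg_linear] linear_scale[OF dg_linear]
  linear_add[OF dg_bilinear[unfolded bilinear_def, THEN conjunct1, rule_format]]
  linear_add[OF dg_bilinear[unfolded bilinear_def, THEN conjunct2, rule_format]]
  linear_scale[OF dg_bilinear[unfolded bilinear_def, THEN conjunct1, rule_format]]
  linear_scale[OF dg_bilinear[unfolded bilinear_def, THEN conjunct2, rule_format]]

text \<open>Justifies the \<open>THE\<close> in \<open>\<Gamma>\<close>: the right-hand side is
  linear in \<open>w\<close>, so \<open>representer\<close> supplies a vector, and nondegeneracy
  makes it unique.\<close>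

lemma Gamma_koszul:
  assumes x: "x \<in> U"
  shows "2 * g x (\<Gamma> x u v) w = dg x v w u + dg x u w v - dg x u v w"
proof -
  interpret inner_form "g x" by (rule form[OF x])
  have "linear (\<lambda>w. (dg x v w u + dg x u w v - dg x u v w) / 2)"
    by (rule linearI) (simp_all add: dg_simps[OF x] field_simps)
  from representer[OF this] obtain z where
    zz: "\<And>w. g x z w = (dg x v w u + dg x u w v - dg x u v w) / 2" by blast
  have z: "2 * g x z w = dg x v w u + dg x u w v - dg x u v w" for w
    by (subst zz) simp
  have "\<Gamma> x u v = z"
    unfolding \<Gamma>_def
  proof (rule the_equality)
    show "\<forall>w. 2 * g x z w = dg x v w u + dg x u w v - dg x u v w" using z by blast
    fix z' assume *: "\<forall>w. 2 * g x z' w = dg x v w u + dg x u w v - dg x u v w"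
    have "2 * g x z' w = 2 * g x z w" for w by (simp only: * z)
    then show "z' = z" by (intro form_eqI) simp
  qed
  then show ?thesis using z by blast
qed

lemma Gamma_eqI:
  assumes "x \<in> U" "\<And>w. 2 * g x z w = dg x v w u + dg x u w v - dg x u v w"
  shows "\<Gamma> x u v = z"
proof -
  have "2 * g x (\<Gamma> x u v) w = 2 * g x z w" for w
    by (simp only: Gamma_koszul[OF assms(1)] assms(2))
  then show ?thesis by (intro inner_form.form_eqI[OF form[OF assms(1)]]) simp
qed

lemma Gamma_linear_left: "linear (\<lambda>u. \<Gamma> x u v)"
  and Gamma_linear_right: "linear (\<Gamma> x u)" if x: "x \<in> U"
proof -
  interpret inner_form "g x" by (rule form[OF x])
  show "linear (\<lambda>u. \<Gamma> x u v)"
    by (rule linearI; rule Gamma_eqI[OF x])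
       (simp_all add: form_simps Gamma_koszul[OF x] dg_simps[OF x] distrib_left right_diff_distrib
         mult.left_commute[of 2])
  show "linear (\<Gamma> x u)"
    by (rule linearI; rule Gamma_eqI[OF x])
       (simp_all add: form_simps Gamma_koszul[OF x] dg_simps[OF x] distrib_left right_diff_distrib
         mult.left_commute[of 2])
qed

text \<open>Metric compatibility of the connection. Add the Koszul formula and its copy with
  \<open>v\<close> and \<open>w\<close> exchanged: by the symmetry of \<open>dg\<close> four of the
  six terms cancel and the other two coincide.\<close>

lemma Gamma_compatible:
  assumes x: "x \<in> U"
  shows "g x (\<Gamma> x u v) w + g x v (\<Gamma> x u w) = dg x v w u"
proof -
  interpret inner_form "g x" by (rule form[OF x])
  show ?thesis
    using Gamma_koszul[OF x, of u v w] Gamma_koszul[OF x, of u w v] sym[of v "\<Gamma> x u w"]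
      dg_sym[OF x, of v w u] dg_sym[OF x, of u v w] by simp
qed

text \<open>The ordinary product rule has a third term, the derivative of the metric itself along
  the curve; \<open>Gamma_compatible\<close> splits it into the two Christoffel corrections.\<close>

lemma has_derivative_along:
  assumes t: "t \<in> I" and U: "\<And>\<tau>. \<tau> \<in> I \<Longrightarrow> x \<tau> \<in> U"
    and x: "(x has_vector_derivative x') (at t within I)"
    and X: "(X has_vector_derivative X') (at t within I)"
    and Y: "(Y has_vector_derivative Y') (at t within I)"
  shows "((\<lambda>\<tau>. g (x \<tau>) (X \<tau>) (Y \<tau>)) has_vector_derivative
     (g (x t) (X' + \<Gamma> (x t) x' (X t)) (Y t) + g (x t) (X t) (Y' + \<Gamma> (x t) x' (Y t)))) (at t within I)"
proof -
  have xt: "x t \<in> U" using t U by blast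
  interpret inner_form "g (x t)" by (rule form[OF xt])
  \<comment> \<open>Base point and both vectors vary together. In basis components each term is a
    product of three real functions, to which the elementary rule applies.\<close>
  let ?S = "\<lambda>\<tau>. \<Sum>i\<in>Basis. \<Sum>j\<in>Basis. (X \<tau> \<bullet> i) * (Y \<tau> \<bullet> j) * g (x \<tau>) i j"
  have gd: "((\<lambda>\<tau>. g (x \<tau>) i j) has_vector_derivative dg (x t) i j x') (at t within I)" for i j
  proof -
    have "((\<lambda>\<tau>. g (x \<tau>) i j) has_derivative (\<lambda>h. dg (x t) i j (h *\<^sub>R x'))) (at t within I)"
      using has_derivative_compose[OF x[unfolded has_vector_derivative_def] has_derivative_dg[OF xt]] .
    then show ?thesis
      by (simp add: has_vector_derivative_def linear_scale[OF dg_linear[OF xt]])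
  qed
  have Xd: "((\<lambda>\<tau>. X \<tau> \<bullet> i) has_vector_derivative X' \<bullet> i) (at t within I)" for i
    using bounded_linear.has_vector_derivative[OF bounded_linear_inner_left X] .
  have Yd: "((\<lambda>\<tau>. Y \<tau> \<bullet> i) has_vector_derivative Y' \<bullet> i) (at t within I)" for i
    using bounded_linear.has_vector_derivative[OF bounded_linear_inner_left Y] .
  have "(?S has_vector_derivative
      (\<Sum>i\<in>Basis. \<Sum>j\<in>Basis. (X t \<bullet> i) * (Y t \<bullet> j) * dg (x t) i j x' +
         ((X t \<bullet> i) * (Y' \<bullet> j) + (X' \<bullet> i) * (Y t \<bullet> j)) * g (x t) i j)) (at t within I)"
    by (intro has_vector_derivative_sum has_vector_derivative_mult gd Xd Yd)
  also have "(\<Sum>i\<in>Basis. \<Sum>j\<in>Basis. (X t \<bullet> i) * (Y t \<bullet> j) * dg (x t) i j x' +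
         ((X t \<bullet> i) * (Y' \<bullet> j) + (X' \<bullet> i) * (Y t \<bullet> j)) * g (x t) i j) =
       dg (x t) (X t) (Y t) x' + (g (x t) (X t) Y' + g (x t) X' (Y t))"
    unfolding bilinear_expand[OF dg_bilinear[OF xt, of x'], of "X t" "Y t"]
      bilinear_expand[OF bil, of "X t" Y'] bilinear_expand[OF bil, of X' "Y t"]
    by (simp add: sum.distrib[symmetric] distrib_right)
  also have "\<dots> = g (x t) (X' + \<Gamma> (x t) x' (X t)) (Y t) + g (x t) (X t) (Y' + \<Gamma> (x t) x' (Y t))"
    using Gamma_compatible[OF xt, of x' "X t" "Y t"] by (simp add: form_simps)
  finally show ?thesis
    by (rule has_vector_derivative_transform[OF t, rotated])
       (use bilinear_expand inner_form.bil[OF form[OF U]] in blast)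
qed

end

section \<open>Charts and curves\<close>

lemma chart_inj: "is_chart X c \<Longrightarrow> inj_on (cmap c) (cdom c)"
  unfolding is_chart_def
  by (metis homeomorphic_imp_injective_map openin_subset topspace_subtopology_subset)

lemma cinv_cmap: "is_chart X c \<Longrightarrow> q \<in> cdom c \<Longrightarrow> cinv c (cmap c q) = q"
  unfolding cinv_def using chart_inj inv_into_f_f by metis

lemma cmap_cinv: "x \<in> cmap c ` cdom c \<Longrightarrow> cmap c (cinv c x) = x"
  and cinv_in: "x \<in> cmap c ` cdom c \<Longrightarrow> cinv c x \<in> cdom c"
  unfolding cinv_def by (simp_all add: f_inv_into_f inv_into_into)

lemma open_chart_image:
  assumes "is_chart X c" "openin X W"
  shows "open (cmap c ` (W \<inter> cdom c))"
proof -
  have "open_map (subtopology X (cdom c)) (top_of_set (cmap c ` cdom c)) (cmap c)"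
    using assms(1) homeomorphic_imp_open_map unfolding is_chart_def by blast
  then have "openin (top_of_set (cmap c ` cdom c)) (cmap c ` (W \<inter> cdom c))"
    using assms(2) unfolding open_map_def openin_subtopology by blast
  then show ?thesis using assms(1) openin_open_eq unfolding is_chart_def by blast
qed

lemma open_chart_overlap:
  "is_chart X c \<Longrightarrow> is_chart X d \<Longrightarrow> open (cmap c ` (cdom c \<inter> cdom d))"
  using open_chart_image[of X c "cdom d"] by (simp add: is_chart_def Int_commute)

lemma continuous_map_cinv:
  assumes "is_chart X c"
  shows "continuous_map (top_of_set (cmap c ` cdom c)) X (cinv c)"
  unfolding continuous_map_def
proof (intro conjI allI impI)
  show "cinv c \<in> topspace (top_of_set (cmap c ` cdom c)) \<rightarrow> topspace X"
    using assms cinv_in[of _ c] openin_subset unfolding is_chart_def by fastforce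
  fix U assume U: "openin X U"
  have "{x \<in> topspace (top_of_set (cmap c ` cdom c)). cinv c x \<in> U} = cmap c ` (U \<inter> cdom c)"
    using cinv_cmap[OF assms] by auto
  then show "openin (top_of_set (cmap c ` cdom c)) {x \<in> topspace (top_of_set (cmap c ` cdom c)). cinv c x \<in> U}"
    using open_chart_image[OF assms U] by (auto intro!: open_subset)
qed

lemma openin_curve_preimage:
  "continuous_map (top_of_set I) X \<alpha> \<Longrightarrow> openin X W \<Longrightarrow> openin (top_of_set I) {t \<in> I. \<alpha> t \<in> W}"
  using openin_continuous_map_preimage by fastforce

text \<open>Class 2 rather than 3, so that one notion covers two charts of the atlas as well as an
  atlas chart paired with a chart that flattens the hypersurface.\<close>

definition compatible ::
    "'a topology \<Rightarrow> ('a, 'e::euclidean_space) chart \<Rightarrow> ('a, 'e) chart \<Rightarrow> bool" where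
  "compatible X c d \<longleftrightarrow> is_chart X c \<and> is_chart X d \<and> Ck_compatible 2 c d"

lemma compatible_sym: "compatible X c d \<Longrightarrow> compatible X d c"
  by (simp add: compatible_def Ck_compatible_def Int_commute)

text \<open>The differential of the coordinate change, indexed by the point of the manifold.
  \<open>to_chart\<close> and \<open>from_chart\<close> are the cases in which one of the two charts
  is \<open>chart_at M p\<close>.\<close>

definition transition_deriv :: "('a, 'e::euclidean_space) chart \<Rightarrow> ('a, 'e) chart \<Rightarrow> 'a \<Rightarrow> 'e \<Rightarrow> 'e" where
  "transition_deriv c d p = frechet_derivative (transition c d) (at (cmap c p))"

lemma transition_cmap: "is_chart X c \<Longrightarrow> p \<in> cdom c \<Longrightarrow> transition c d (cmap c p) = cmap d p"
  by (simp add: transition_def cinv_cmap)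

lemma transition_has_derivative:
  assumes "compatible X c d" "p \<in> cdom c" "p \<in> cdom d"
  shows "(transition c d has_derivative transition_deriv c d p) (at (cmap c p))"
proof -
  have "Ck_on 2 (transition c d) (cmap c ` (cdom c \<inter> cdom d))"
    using assms(1) by (auto simp: compatible_def Ck_compatible_def)
  then have "transition c d differentiable_on (cmap c ` (cdom c \<inter> cdom d))"
    by (simp add: numeral_2_eq_2)
  moreover have "open (cmap c ` (cdom c \<inter> cdom d))"
    using assms(1) open_chart_overlap unfolding compatible_def by blast
  ultimately show ?thesis unfolding transition_deriv_def
    using assms(2,3) by (simp add: differentiable_on_eq_differentiable_at frechet_derivative_works)
qed

lemma transition_deriv_linear: "compatible X c d \<Longrightarrow> p \<in> cdom c \<Longrightarrow> p \<in> cdom d \<Longrightarrow> linear (transition_deriv c d p)"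
  by (rule has_derivative_linear[OF transition_has_derivative])

lemma transition_deriv_refl: "transition_deriv c c p = (\<lambda>v. v)" if "is_chart X c" "p \<in> cdom c"
proof -
  have "(transition c c has_derivative (\<lambda>v. v)) (at (cmap c p))"
    by (rule has_derivative_transform_within_open[of "\<lambda>v. v" _ _ _ "cmap c ` cdom c"])
       (use that transition_cmap[OF that(1), of _ c] in \<open>auto simp: is_chart_def\<close>)
  then show ?thesis unfolding transition_deriv_def by (simp flip: frechet_derivative_at)
qed

lemma transition_deriv_trans:
  assumes "compatible X c d" "compatible X d e" "p \<in> cdom c" "p \<in> cdom d" "p \<in> cdom e"
  shows "transition_deriv c e p v = transition_deriv d e p (transition_deriv c d p v)"
proof -
  have ch: "is_chart X c" "is_chart X d" using assms by (auto simp: compatible_def)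
  have "(transition d e has_derivative transition_deriv d e p) (at (transition c d (cmap c p)))"
    using transition_has_derivative[OF assms(2)] assms(3-) transition_cmap[OF ch(1)] by simp
  from has_derivative_compose[OF transition_has_derivative[OF assms(1,3,4)] this]
  have "((\<lambda>x. transition d e (transition c d x)) has_derivative (\<lambda>v. transition_deriv d e p (transition_deriv c d p v)))
    (at (cmap c p))" .
  then have "(transition c e has_derivative (\<lambda>v. transition_deriv d e p (transition_deriv c d p v))) (at (cmap c p))"
    by (rule has_derivative_transform_within_open[OF _ open_chart_overlap[OF ch]])
       (use assms(3,4) in \<open>auto simp: transition_cmap[OF ch(1)] transition_cmap[OF ch(2)]\<close>)
  then show ?thesis unfolding transition_deriv_def[of c e] by (simp flip: frechet_derivative_at)
qed

lemma transition_deriv_inverse: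
  assumes "compatible X c d" "p \<in> cdom c" "p \<in> cdom d"
  shows "transition_deriv d c p (transition_deriv c d p v) = v"
  using transition_deriv_trans[OF assms(1) compatible_sym[OF assms(1)] assms(2,3,2)] transition_deriv_refl[of X c p] assms
  by (simp add: compatible_def)

lemma curve_transition:
  assumes c: "compatible X c d" and \<alpha>: "continuous_map (top_of_set I) X \<alpha>"
    and t: "t \<in> I" "\<alpha> t \<in> cdom c" "\<alpha> t \<in> cdom d"
    and v: "(cmap c \<circ> \<alpha> has_vector_derivative v) (at t within I)"
  shows "(cmap d \<circ> \<alpha> has_vector_derivative transition_deriv c d (\<alpha> t) v) (at t within I)"
proof -
  \<comment> \<open>The chain rule identifies the two coordinate expressions only while the curve is
    in the domain of \<open>c\<close>. That set of parameters is relatively open in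
    \<open>I\<close>, so the derivative at \<open>t\<close> is unaffected by the
    restriction.\<close>
  define S where "S = {\<tau> \<in> I. \<alpha> \<tau> \<in> cdom c}"
  have ch: "is_chart X c" using c by (auto simp: compatible_def)
  have S: "openin (top_of_set I) S" unfolding S_def
    by (rule openin_curve_preimage[OF \<alpha>]) (use ch in \<open>auto simp: is_chart_def\<close>)
  have tS: "t \<in> S" using t by (simp add: S_def)
  have at: "at t within S = at t within I" by (rule at_within_openin_eq[OF S tS])
  have "(transition c d has_derivative transition_deriv c d (\<alpha> t)) (at ((cmap c \<circ> \<alpha>) t))"
    using transition_has_derivative[OF c t(2,3)] by simp
  from has_derivative_compose[OF v[unfolded has_vector_derivative_def] this]
  have "((\<lambda>\<tau>. transition c d ((cmap c \<circ> \<alpha>) \<tau>)) has_vector_derivative transition_deriv c d (\<alpha> t) v) (at t within S)"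
    by (simp add: has_vector_derivative_def at linear_scale[OF transition_deriv_linear[OF c t(2,3)]])
  then have "(cmap d \<circ> \<alpha> has_vector_derivative transition_deriv c d (\<alpha> t) v) (at t within S)"
    by (rule has_vector_derivative_transform[OF tS, rotated])
       (simp add: S_def transition_cmap[OF ch])
  then show ?thesis by (simp add: at)
qed

lemma at_within_interval_neq_bot:
  fixes I :: "real set"
  assumes "is_interval I" "interior I \<noteq> {}" "t \<in> I"
  shows "at t within I \<noteq> bot"
proof -
  have "accessible I" using assms openin_interval_accessible[of I I] by auto
  then show ?thesis
    using assms(3) unfolding trivial_limit_within islimpt_approachable_real accessible_def
    by (force dest!: bspec)
qed

section \<open>Riemannian manifolds: components in charts, velocities, covariant derivatives along
  curves\<close>

locale riem_mfd =
  fixes M :: "('a, 'e::euclidean_space) riemannian"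
  assumes mfd: "riemannian_manifold M"
begin

lemma atlas_chart: "c \<in> atlas M \<Longrightarrow> is_chart (pts M) c"
  using mfd by (simp add: riemannian_manifold_def)

lemma atlas_compatible:
  assumes "c \<in> atlas M" "d \<in> atlas M"
  shows "compatible (pts M) c d"
proof -
  have "Ck_compatible 3 c d" using mfd assms unfolding riemannian_manifold_def by blast
  then have "Ck_compatible 2 c d" unfolding Ck_compatible_def by (auto elim!: Ck_on_mono)
  then show ?thesis using atlas_chart assms by (simp add: compatible_def)
qed

lemma chart_at: "chart_at M p \<in> atlas M" "p \<in> cdom (chart_at M p)" if "p \<in> topspace (pts M)"
proof -
  have "p \<in> (\<Union>c\<in>atlas M. cdom c)" using mfd that by (simp add: riemannian_manifold_def)
  then have "\<exists>c. c \<in> atlas M \<and> p \<in> cdom c" by blast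
  from someI_ex[OF this] show "chart_at M p \<in> atlas M" "p \<in> cdom (chart_at M p)"
    by (auto simp: chart_at_def)
qed

lemma cdom_topspace: "c \<in> atlas M \<Longrightarrow> p \<in> cdom c \<Longrightarrow> p \<in> topspace (pts M)"
  using atlas_chart openin_subset unfolding is_chart_def by blast

lemma to_chart_eq: "to_chart M c p = transition_deriv (chart_at M p) c p"
  and from_chart_eq: "from_chart M c p = transition_deriv c (chart_at M p) p"
  by (auto simp: to_chart_def from_chart_def transition_deriv_def)

lemma chart_at_compatible: "c \<in> atlas M \<Longrightarrow> p \<in> cdom c \<Longrightarrow> compatible (pts M) (chart_at M p) c"
  using atlas_compatible chart_at cdom_topspace by blast

context
  fixes c p assumes c: "c \<in> atlas M" "p \<in> cdom c"
begin

lemma to_chart_linear: "linear (to_chart M c p)"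
  unfolding to_chart_eq
  by (rule transition_deriv_linear[OF chart_at_compatible[OF c] chart_at(2)[OF cdom_topspace[OF c]] c(2)])

lemma from_chart_linear: "linear (from_chart M c p)"
  unfolding from_chart_eq
  by (rule transition_deriv_linear[OF compatible_sym[OF chart_at_compatible[OF c]] c(2)
        chart_at(2)[OF cdom_topspace[OF c]]])

lemma from_to_chart: "from_chart M c p (to_chart M c p v) = v"
  unfolding from_chart_eq to_chart_eq
  by (rule transition_deriv_inverse[OF chart_at_compatible[OF c] chart_at(2)[OF cdom_topspace[OF c]] c(2)])

lemma to_from_chart: "to_chart M c p (from_chart M c p v) = v"
  unfolding from_chart_eq to_chart_eq
  by (rule transition_deriv_inverse[OF compatible_sym[OF chart_at_compatible[OF c]] c(2)
        chart_at(2)[OF cdom_topspace[OF c]]])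

end

lemma to_chart_at: "p \<in> topspace (pts M) \<Longrightarrow> to_chart M (chart_at M p) p v = v"
  unfolding to_chart_eq using transition_deriv_refl[OF atlas_chart] chart_at by metis

lemma inner_form_riem: "p \<in> topspace (pts M) \<Longrightarrow> inner_form (riem M p)"
  using mfd unfolding riemannian_manifold_def by unfold_locales auto

lemma riem_in_to_chart:
  assumes "c \<in> atlas M" "p \<in> cdom c"
  shows "riem_in M c (cmap c p) (to_chart M c p u) (to_chart M c p v) = riem M p u v"
  using assms by (simp add: riem_in_def cinv_cmap[OF atlas_chart] from_to_chart)

lemma metric_field_riem_in:
  assumes c: "c \<in> atlas M"
  shows "metric_field (riem_in M c) (cmap c ` cdom c)"
proof (rule metric_field.intro)
  show op: "open (cmap c ` cdom c)" using atlas_chart[OF c] by (simp add: is_chart_def)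
  show "inner_form (riem_in M c x)" if "x \<in> cmap c ` cdom c" for x
  proof -
    let ?p = "cinv c x"
    have p: "?p \<in> cdom c" using cinv_in[OF that] .
    interpret inner_form "riem M ?p" by (rule inner_form_riem[OF cdom_topspace[OF c p]])
    note l = from_chart_linear[OF c p]
    show ?thesis
    proof
      show "bilinear (riem_in M c x)" unfolding bilinear_def riem_in_def
        by (auto intro!: linearI simp: linear_add[OF l] linear_scale[OF l] form_simps)
      show "riem_in M c x u v = riem_in M c x v u" for u v
        unfolding riem_in_def by (rule sym)
      show "riem_in M c x v v > 0" if "v \<noteq> 0" for v
        unfolding riem_in_def using to_from_chart[OF c p, of v] that
          linear_0[OF to_chart_linear[OF c p]] by (intro pos) metis
    qed
  qed
  show "(\<lambda>y. riem_in M c y u v) differentiable (at x)" if "x \<in> cmap c ` cdom c" for x u v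
  proof -
    have "Ck_on 2 (\<lambda>y. riem_in M c y u v) (cmap c ` cdom c)"
      using mfd c unfolding riemannian_manifold_def by blast
    then show ?thesis
      using that op by (auto simp: numeral_2_eq_2 differentiable_on_eq_differentiable_at)
  qed
qed

lemma christoffel_eq: "c \<in> atlas M \<Longrightarrow> christoffel M c = metric_field.\<Gamma> (riem_in M c)"
  using metric_field.\<Gamma>_def[OF metric_field_riem_in] metric_field.dg_def[OF metric_field_riem_in]
  by (auto simp: christoffel_def fun_eq_iff)

lemma christoffel_linear:
  assumes "p \<in> topspace (pts M)"
  shows "linear (\<lambda>u. christoffel M (chart_at M p) (cmap (chart_at M p) p) u v)"
    and "linear (christoffel M (chart_at M p) (cmap (chart_at M p) p) u)"
  using chart_at(2)[OF assms]
  by (simp_all add: christoffel_eq[OF chart_at(1)[OF assms]]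
      metric_field.Gamma_linear_left[OF metric_field_riem_in[OF chart_at(1)[OF assms]]]
      metric_field.Gamma_linear_right[OF metric_field_riem_in[OF chart_at(1)[OF assms]]])

lemma Ck_curve_mono: "Ck_curve l M I \<alpha> \<Longrightarrow> k \<le> l \<Longrightarrow> Ck_curve k M I \<alpha>"
  unfolding Ck_curve_def using Ck_on_mono by blast

context
  fixes I :: "real set" and \<alpha> :: "real \<Rightarrow> 'a"
  assumes curve: "Ck_curve 1 M I \<alpha>"
begin

lemma curve_topspace: "t \<in> I \<Longrightarrow> \<alpha> t \<in> topspace (pts M)"
  using curve unfolding Ck_curve_def continuous_map_def by auto

lemma curve_continuous: "continuous_map (top_of_set I) (pts M) \<alpha>"
  using curve unfolding Ck_curve_def by blast

lemma curve_at_neq_bot: "t \<in> I \<Longrightarrow> at t within I \<noteq> bot"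
  using curve at_within_interval_neq_bot unfolding Ck_curve_def by blast

lemma openin_curve_chart: "c \<in> atlas M \<Longrightarrow> openin (top_of_set I) {t \<in> I. \<alpha> t \<in> cdom c}"
  using openin_curve_preimage[OF curve_continuous] atlas_chart unfolding is_chart_def by blast

lemma at_within_curve_chart:
  "c \<in> atlas M \<Longrightarrow> t \<in> I \<Longrightarrow> \<alpha> t \<in> cdom c \<Longrightarrow> at t within {t \<in> I. \<alpha> t \<in> cdom c} = at t within I"
  using at_within_openin_eq[OF openin_curve_chart] by simp

lemma velocity_eqI:
  assumes "t \<in> I" "(cmap (chart_at M (\<alpha> t)) \<circ> \<alpha> has_vector_derivative v) (at t within I)"
  shows "velocity M I \<alpha> t = v"
  unfolding velocity_def by (rule vector_derivative_within[OF curve_at_neq_bot assms(2)]) fact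

text \<open>\<open>velocity\<close> uses a chart that depends on \<open>t\<close>. This converts it
  to a chart \<open>c\<close> that can be held fixed while \<open>t\<close> varies.\<close>

lemma velocity_chart:
  assumes t: "t \<in> I" and c: "c \<in> atlas M" "\<alpha> t \<in> cdom c"
  shows "(cmap c \<circ> \<alpha> has_vector_derivative to_chart M c (\<alpha> t) (velocity M I \<alpha> t)) (at t within I)"
proof -
  define c0 where "c0 = chart_at M (\<alpha> t)"
  have c0: "c0 \<in> atlas M" "\<alpha> t \<in> cdom c0" using chart_at[OF curve_topspace[OF t]] by (auto simp: c0_def)
  have "Ck_on 1 (cmap c0 \<circ> \<alpha>) {t \<in> I. \<alpha> t \<in> cdom c0}" using curve c0 unfolding Ck_curve_def by blast
  then have "(cmap c0 \<circ> \<alpha>) differentiable (at t within I)"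
    using t c0 at_within_curve_chart[OF c0(1) t c0(2)] by (auto simp: differentiable_on_def)
  then have "(cmap c0 \<circ> \<alpha> has_vector_derivative velocity M I \<alpha> t) (at t within I)"
    unfolding velocity_def c0_def[symmetric] by (simp add: vector_derivative_works)
  from curve_transition[OF atlas_compatible[OF c0(1) c(1)] curve_continuous t c0(2) c(2) this]
  show ?thesis unfolding to_chart_eq c0_def[symmetric] .
qed

lemma field_along_has_derivative:
  assumes "Ck_field_along 1 M I \<alpha> X" and t: "t \<in> I" and c: "c \<in> atlas M" "\<alpha> t \<in> cdom c"
  shows "((\<lambda>\<tau>. to_chart M c (\<alpha> \<tau>) (X \<tau>)) has_vector_derivative
      vector_derivative (\<lambda>\<tau>. to_chart M c (\<alpha> \<tau>) (X \<tau>)) (at t within I)) (at t within I)"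
proof -
  have "Ck_on 1 (\<lambda>\<tau>. to_chart M c (\<alpha> \<tau>) (X \<tau>)) {t \<in> I. \<alpha> t \<in> cdom c}"
    using assms c unfolding Ck_field_along_def by blast
  then show ?thesis
    using t c at_within_curve_chart[OF c(1) t c(2)]
    by (auto simp: differentiable_on_def vector_derivative_works)
qed

text \<open>Freeze the preferred chart of \<open>\<alpha> t\<close> and apply
  \<open>has_derivative_along\<close> there. At \<open>\<tau> = t\<close> the map
  \<open>to_chart\<close> is the identity, so the corrected chart derivatives are exactly the two
  values of \<open>cov_deriv\<close>.\<close>

lemma riem_has_derivative:
  assumes X: "Ck_field_along 1 M I \<alpha> X" and Y: "Ck_field_along 1 M I \<alpha> Y" and t: "t \<in> I"
  shows "((\<lambda>\<tau>. riem M (\<alpha> \<tau>) (X \<tau>) (Y \<tau>)) has_vector_derivative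
     riem M (\<alpha> t) (cov_deriv M I \<alpha> X t) (Y t) + riem M (\<alpha> t) (X t) (cov_deriv M I \<alpha> Y t))
     (at t within I)"
proof -
  define c where "c = chart_at M (\<alpha> t)"
  have p: "\<alpha> t \<in> topspace (pts M)" using curve_topspace[OF t] .
  have c: "c \<in> atlas M" "\<alpha> t \<in> cdom c" using chart_at[OF p] by (auto simp: c_def)
  have id: "to_chart M c (\<alpha> t) v = v" for v unfolding c_def using to_chart_at[OF p] .
  let ?S = "{\<tau> \<in> I. \<alpha> \<tau> \<in> cdom c}"
  have tS: "t \<in> ?S" using t c by simp
  note at = at_within_curve_chart[OF c(1) t c(2)]
  interpret metric_field "riem_in M c" "cmap c ` cdom c" by (rule metric_field_riem_in[OF c(1)])
  have r: "riem_in M c (cmap c (\<alpha> t)) u v = riem M (\<alpha> t) u v" for u v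
    using riem_in_to_chart[OF c] by (simp add: id)
  have "((\<lambda>\<tau>. riem_in M c ((cmap c \<circ> \<alpha>) \<tau>) (to_chart M c (\<alpha> \<tau>) (X \<tau>)) (to_chart M c (\<alpha> \<tau>) (Y \<tau>)))
     has_vector_derivative
     riem M (\<alpha> t) (cov_deriv M I \<alpha> X t) (Y t) + riem M (\<alpha> t) (X t) (cov_deriv M I \<alpha> Y t))
     (at t within ?S)"
    using has_derivative_along[OF tS _ velocity_chart[OF t c, folded at]
        field_along_has_derivative[OF X t c, folded at] field_along_has_derivative[OF Y t c, folded at]]
    by (simp add: cov_deriv_def c_def[symmetric] at id r christoffel_eq[OF c(1)])
  then have "((\<lambda>\<tau>. riem M (\<alpha> \<tau>) (X \<tau>) (Y \<tau>)) has_vector_derivative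
     riem M (\<alpha> t) (cov_deriv M I \<alpha> X t) (Y t) + riem M (\<alpha> t) (X t) (cov_deriv M I \<alpha> Y t))
     (at t within ?S)"
    by (rule has_vector_derivative_transform[OF tS, rotated]) (simp add: riem_in_to_chart[OF c(1)])
  then show ?thesis by (simp add: at)
qed

text \<open>With constant coefficients no derivatives of the \<open>a i\<close> appear; this is the
  form in which the expansion of the normal in the frame gets differentiated.\<close>

lemma cov_deriv_sum:
  assumes X: "\<And>i. i \<in> A \<Longrightarrow> Ck_field_along 1 M I \<alpha> (X i)" and t: "t \<in> I"
    and Z: "\<And>\<tau>. \<tau> \<in> I \<Longrightarrow> Z \<tau> = (\<Sum>i\<in>A. a i *\<^sub>R X i \<tau>)"
  shows "cov_deriv M I \<alpha> Z t = (\<Sum>i\<in>A. a i *\<^sub>R cov_deriv M I \<alpha> (X i) t)"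
proof -
  define c where "c = chart_at M (\<alpha> t)"
  have p: "\<alpha> t \<in> topspace (pts M)" using curve_topspace[OF t] .
  have c: "c \<in> atlas M" "\<alpha> t \<in> cdom c" using chart_at[OF p] by (auto simp: c_def)
  let ?S = "{\<tau> \<in> I. \<alpha> \<tau> \<in> cdom c}"
  let ?X = "\<lambda>i \<tau>. to_chart M c (\<alpha> \<tau>) (X i \<tau>)"
  have tS: "t \<in> ?S" using t c by simp
  note at = at_within_curve_chart[OF c(1) t c(2)]
  have "((\<lambda>\<tau>. \<Sum>i\<in>A. a i *\<^sub>R ?X i \<tau>) has_vector_derivative
      (\<Sum>i\<in>A. a i *\<^sub>R vector_derivative (?X i) (at t within I))) (at t within ?S)"
    unfolding at
    by (intro has_vector_derivative_sum
        bounded_linear.has_vector_derivative[OF bounded_linear_scaleR_right]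
        field_along_has_derivative[OF X t c])
  then have "((\<lambda>\<tau>. to_chart M c (\<alpha> \<tau>) (Z \<tau>)) has_vector_derivative
      (\<Sum>i\<in>A. a i *\<^sub>R vector_derivative (?X i) (at t within I))) (at t within ?S)"
    by (rule has_vector_derivative_transform[OF tS, rotated])
       (simp add: Z linear_sum[OF to_chart_linear[OF c(1)]] linear_scale[OF to_chart_linear[OF c(1)]])
  then have "vector_derivative (\<lambda>\<tau>. to_chart M c (\<alpha> \<tau>) (Z \<tau>)) (at t within I) =
      (\<Sum>i\<in>A. a i *\<^sub>R vector_derivative (?X i) (at t within I))"
    unfolding at by (rule vector_derivative_within[OF curve_at_neq_bot[OF t]])
  then show ?thesis
    using christoffel_linear(2)[OF p, folded c_def]
    by (simp add: cov_deriv_def c_def[symmetric] Z[OF t] linear_sum linear_scale scaleR_add_right sum.distrib)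
qed

end

end

section \<open>Hypersurfaces and the shape operator\<close>

lemma eigenvectors_imp_scalar:
  fixes L :: "'e::real_vector \<Rightarrow> 'e"
  assumes L: "linear L" and T: "subspace T" and eig: "\<And>v. v \<in> T \<Longrightarrow> \<exists>l. L v = l *\<^sub>R v"
  shows "\<exists>l. \<forall>v\<in>T. L v = l *\<^sub>R v"
proof (cases "T \<subseteq> {0}")
  case True
  then have "\<forall>v\<in>T. L v = 0 *\<^sub>R v" using linear_0[OF L] by auto
  then show ?thesis by blast
next
  case False
  then obtain u where u: "u \<in> T" "u \<noteq> 0" by blast
  obtain l where l: "L u = l *\<^sub>R u" using eig[OF u(1)] by blast
  have "L v = l *\<^sub>R v" if v: "v \<in> T" for v
  proof -
    obtain m where m: "L v = m *\<^sub>R v" using eig[OF v] by blast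
    obtain k where "L (u + v) = k *\<^sub>R (u + v)" using eig[OF subspace_add[OF T u(1) v]] by blast
    \<comment> \<open>Comparing the eigenvalues \<open>l\<close>, \<open>m\<close>, \<open>k\<close>
      of \<open>u\<close>, \<open>v\<close>, \<open>u + v\<close>: if \<open>k = m\<close>, then
      \<open>l = k\<close> because \<open>u\<close> is nonzero; otherwise \<open>v\<close> is a
      multiple of \<open>u\<close> and shares its eigenvalue.\<close>
    then have *: "(l - k) *\<^sub>R u = (k - m) *\<^sub>R v"
      by (simp add: linear_add[OF L] l m algebra_simps)
    show ?thesis
    proof (cases "k = m")
      case True
      then show ?thesis using * u m by auto
    next
      case False
      then have "v = ((l - k) / (k - m)) *\<^sub>R u"
        using arg_cong[OF *, of "\<lambda>x. (1 / (k - m)) *\<^sub>R x"] by simp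
      then obtain r where "v = r *\<^sub>R u" by blast
      then show ?thesis by (simp add: linear_scale[OF L] l)
    qed
  qed
  then show ?thesis by blast
qed

locale hypersurface_mfd = riem_mfd M for M :: "('a, 'e::euclidean_space) riemannian" +
  fixes N :: "'a set" and \<xi> :: "'a \<Rightarrow> 'e"
  assumes hyp: "hypersurface M N" and normal: "unit_normal_field M N \<xi>"
begin

lemma N_topspace: "p \<in> N \<Longrightarrow> p \<in> topspace (pts M)"
  using hyp unfolding hypersurface_def by blast

lemma extension_in_chart:
  assumes "Ck_field 1 M W F" "openin (pts M) W" "c \<in> atlas M" "q \<in> W" "q \<in> cdom c"
  shows "((\<lambda>x. to_chart M c (cinv c x) (F (cinv c x))) has_derivative
     frechet_derivative (\<lambda>x. to_chart M c (cinv c x) (F (cinv c x))) (at (cmap c q))) (at (cmap c q))"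
proof -
  have "open (cmap c ` (W \<inter> cdom c))" using open_chart_image[OF atlas_chart[OF assms(3)] assms(2)] .
  moreover have "Ck_on 1 (\<lambda>x. to_chart M c (cinv c x) (F (cinv c x))) (cmap c ` (W \<inter> cdom c))"
    using assms(1,3) unfolding Ck_field_def by blast
  ultimately show ?thesis
    using assms(4,5) by (simp add: differentiable_on_eq_differentiable_at flip: frechet_derivative_works)
qed

text \<open>Near \<open>t\<close> the curve stays where the extension equals the normal, since it
  lies in \<open>N\<close>. Both sides use the preferred chart of \<open>\<alpha> t\<close> and the
  same Christoffel term, so what remains is the chain rule for the component function.\<close>

lemma cov_deriv_eq_nabla:
  assumes \<alpha>: "Ck_curve 1 M I \<alpha>" "\<alpha> ` I \<subseteq> N" and t: "t \<in> I"
    and F: "local_extension M N \<xi> (\<alpha> t) F"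
  shows "cov_deriv M I \<alpha> (\<xi> \<circ> \<alpha>) t = nabla M F (\<alpha> t) (velocity M I \<alpha> t)"
proof -
  define c where "c = chart_at M (\<alpha> t)"
  have p: "\<alpha> t \<in> topspace (pts M)" using curve_topspace[OF \<alpha>(1) t] .
  have c: "c \<in> atlas M" "\<alpha> t \<in> cdom c" using chart_at[OF p] by (auto simp: c_def)
  obtain W where W: "openin (pts M) W" "\<alpha> t \<in> W" "Ck_field 1 M W F" "\<And>q. q \<in> N \<inter> W \<Longrightarrow> F q = \<xi> q"
    using F unfolding local_extension_def by blast
  let ?S = "{\<tau> \<in> I. \<alpha> \<tau> \<in> W \<inter> cdom c}"
  have "openin (pts M) (W \<inter> cdom c)" using W atlas_chart[OF c(1)] by (auto simp: is_chart_def)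
  then have S: "openin (top_of_set I) ?S" using openin_curve_preimage[OF curve_continuous[OF \<alpha>(1)]] by blast
  have tS: "t \<in> ?S" using t c W by simp
  note at = at_within_openin_eq[OF S tS]
  let ?f = "\<lambda>x. to_chart M c (cinv c x) (F (cinv c x))"
  let ?D = "frechet_derivative ?f (at (cmap c (\<alpha> t)))"
  let ?v = "velocity M I \<alpha> t"
  have f: "(?f has_derivative ?D) (at ((cmap c \<circ> \<alpha>) t))"
    using extension_in_chart[OF W(3,1) c(1) W(2) c(2)] by simp
  have "(cmap c \<circ> \<alpha> has_vector_derivative ?v) (at t within ?S)"
    unfolding at using velocity_chart[OF \<alpha>(1) t c] to_chart_at[OF p] by (simp add: c_def)
  from has_derivative_compose[OF this[unfolded has_vector_derivative_def] f]
  have "((\<lambda>\<tau>. ?f ((cmap c \<circ> \<alpha>) \<tau>)) has_vector_derivative ?D ?v) (at t within ?S)"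
    by (simp add: has_vector_derivative_def linear_scale[OF has_derivative_linear[OF f[simplified]]])
  then have "((\<lambda>\<tau>. to_chart M c (\<alpha> \<tau>) ((\<xi> \<circ> \<alpha>) \<tau>)) has_vector_derivative ?D ?v) (at t within ?S)"
    by (rule has_vector_derivative_transform[OF tS, rotated])
       (use W(4) \<alpha>(2) in \<open>auto simp: cinv_cmap[OF atlas_chart[OF c(1)]]\<close>)
  then have "vector_derivative (\<lambda>\<tau>. to_chart M c (\<alpha> \<tau>) ((\<xi> \<circ> \<alpha>) \<tau>)) (at t within I) = ?D ?v"
    unfolding at by (rule vector_derivative_within[OF curve_at_neq_bot[OF \<alpha>(1) t]])
  moreover have "F (\<alpha> t) = \<xi> (\<alpha> t)" using W(2,4) \<alpha>(2) t by blast
  ultimately show ?thesis unfolding cov_deriv_def nabla_def c_def[symmetric] Let_def by simp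
qed

lemma normal_extension: "p \<in> N \<Longrightarrow> \<exists>F. local_extension M N \<xi> p F"
  using normal unfolding unit_normal_field_def by blast

text \<open>The extension \<open>F\<close> changes with the point of \<open>N\<close>, so regularity
  is proved near each parameter and assembled by \<open>Ck_on_local\<close>.\<close>

lemma normal_field_along:
  assumes \<alpha>: "Ck_curve 1 M I \<alpha>" "\<alpha> ` I \<subseteq> N"
  shows "Ck_field_along 1 M I \<alpha> (\<xi> \<circ> \<alpha>)"
  unfolding Ck_field_along_def
proof
  fix c assume c: "c \<in> atlas M"
  note ch = atlas_chart[OF c]
  let ?S = "{t \<in> I. \<alpha> t \<in> cdom c}"
  show "Ck_on 1 (\<lambda>t. to_chart M c (\<alpha> t) ((\<xi> \<circ> \<alpha>) t)) ?S"
  proof (rule Ck_on_local)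
    fix t assume t: "t \<in> ?S"
    then obtain F where "local_extension M N \<xi> (\<alpha> t) F" using normal_extension \<alpha> by blast
    then obtain W where W: "openin (pts M) W" "\<alpha> t \<in> W" "Ck_field 1 M W F" "\<And>q. q \<in> N \<inter> W \<Longrightarrow> F q = \<xi> q"
      unfolding local_extension_def by blast
    let ?T = "{\<tau> \<in> I. \<alpha> \<tau> \<in> W \<inter> cdom c}"
    have "openin (pts M) (W \<inter> cdom c)" using W ch by (auto simp: is_chart_def)
    then have T: "openin (top_of_set I) ?T"
      using openin_curve_preimage[OF curve_continuous[OF \<alpha>(1)]] by blast
    have TS: "openin (top_of_set ?S) ?T"
      by (rule openin_subset_trans[OF T]) auto
    have acc: "accessible ?T"
      using openin_interval_accessible[OF _ _ T] \<alpha>(1) unfolding Ck_curve_def by blast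
    have "Ck_on 1 (cmap c \<circ> \<alpha>) ?S" using \<alpha>(1) c unfolding Ck_curve_def by blast
    then have x: "Ck_on 1 (cmap c \<circ> \<alpha>) ?T" using Ck_on_openin[OF TS] by blast
    have f: "Ck_on 1 (\<lambda>x. to_chart M c (cinv c x) (F (cinv c x))) (cmap c ` (W \<inter> cdom c))"
      using W(3) c unfolding Ck_field_def by blast
    have "Ck_on 1 (\<lambda>\<tau>. to_chart M c (cinv c ((cmap c \<circ> \<alpha>) \<tau>)) (F (cinv c ((cmap c \<circ> \<alpha>) \<tau>)))) ?T"
      by (rule Ck_on_compose[OF acc _ f x]) auto
    then have "Ck_on 1 (\<lambda>t. to_chart M c (\<alpha> t) ((\<xi> \<circ> \<alpha>) t)) ?T"
      by (rule Ck_on_cong[rotated]) (use W(4) \<alpha>(2) in \<open>auto simp: cinv_cmap[OF ch]\<close>)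
    with TS show "\<exists>T. t \<in> T \<and> openin (top_of_set ?S) T \<and>
        Ck_on 1 (\<lambda>t. to_chart M c (\<alpha> t) ((\<xi> \<circ> \<alpha>) t)) T"
      using t W(2) by (intro exI[of _ ?T]) simp
  qed
qed

lemma nabla_linear:
  assumes "p \<in> N" "local_extension M N \<xi> p F"
  shows "linear (nabla M F p)"
proof -
  have p: "p \<in> topspace (pts M)" using N_topspace[OF assms(1)] .
  obtain W where W: "openin (pts M) W" "p \<in> W" "Ck_field 1 M W F"
    using assms(2) unfolding local_extension_def by blast
  note l = has_derivative_linear[OF extension_in_chart[OF W(3,1) chart_at(1)[OF p] W(2) chart_at(2)[OF p]]]
  show ?thesis unfolding nabla_def Let_def
    by (rule linear_compose_add[OF l christoffel_linear(1)[OF p]])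
qed

text \<open>Independence of the extension, which makes the \<open>THE\<close> meaningful:
  \<open>v\<close> is the velocity of some curve in \<open>N\<close>, and for every extension
  \<open>nabla\<close> equals the covariant derivative of the normal along that curve.\<close>

lemma shape_operator_eq:
  assumes p: "p \<in> N" and F: "local_extension M N \<xi> p F" and v: "v \<in> tangent_space M N p"
  shows "shape_operator M N \<xi> p v = - nabla M F p v"
proof -
  obtain I \<gamma> t where g: "Ck_curve 1 M I \<gamma>" "\<gamma> ` I \<subseteq> N" "t \<in> interior I" "\<gamma> t = p" "v = velocity M I \<gamma> t"
    using v unfolding tangent_space_def by blast
  have "t \<in> I" using g(3) interior_subset by blast
  then have "nabla M G p v = cov_deriv M I \<gamma> (\<xi> \<circ> \<gamma>) t" if "local_extension M N \<xi> p G" for G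
    using cov_deriv_eq_nabla[OF g(1,2)] g(4,5) that by auto
  then have "(THE y. \<exists>F. local_extension M N \<xi> p F \<and> y = nabla M F p v) = nabla M F p v"
    by (intro the_equality) (use F in auto)
  then show ?thesis unfolding shape_operator_def by simp
qed

section \<open>Flattening charts and the tangent spaces of the hypersurface\<close>

definition slice :: "'a \<Rightarrow> ('a, 'e) chart \<Rightarrow> 'e \<Rightarrow> bool" where
  "slice p d b \<longleftrightarrow> is_chart (pts M) d \<and> p \<in> cdom d \<and> (\<forall>c\<in>atlas M. compatible (pts M) c d) \<and>
     b \<noteq> 0 \<and> cmap d ` (N \<inter> cdom d) = {x \<in> cmap d ` cdom d. b \<bullet> x = 0}"

lemma slice_exists: "p \<in> N \<Longrightarrow> \<exists>d b. slice p d b"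
  using hyp atlas_chart unfolding hypersurface_def slice_def compatible_def by meson

text \<open>The function \<open>b \<bullet> cmap d (\<alpha> \<tau>)\<close> vanishes identically as
  long as the curve is in the chart, hence so does its derivative. One-sided derivatives are
  covered, so \<open>t\<close> may be an endpoint of \<open>I\<close>.\<close>

lemma velocity_in_slice:
  assumes \<alpha>: "Ck_curve 1 M I \<alpha>" "\<alpha> ` I \<subseteq> N" and t: "t \<in> I" and s: "slice (\<alpha> t) d b"
  shows "b \<bullet> transition_deriv (chart_at M (\<alpha> t)) d (\<alpha> t) (velocity M I \<alpha> t) = 0"
proof -
  define c where "c = chart_at M (\<alpha> t)"
  have p: "\<alpha> t \<in> topspace (pts M)" using curve_topspace[OF \<alpha>(1) t] .
  have c: "c \<in> atlas M" "\<alpha> t \<in> cdom c" using chart_at[OF p] by (auto simp: c_def)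
  have d: "is_chart (pts M) d" "\<alpha> t \<in> cdom d" "compatible (pts M) c d"
    "cmap d ` (N \<inter> cdom d) = {x \<in> cmap d ` cdom d. b \<bullet> x = 0}"
    using s c unfolding slice_def by blast+
  let ?S = "{\<tau> \<in> I. \<alpha> \<tau> \<in> cdom d}"
  have "openin (pts M) (cdom d)" using d by (auto simp: is_chart_def)
  then have S: "openin (top_of_set I) ?S" using openin_curve_preimage[OF curve_continuous[OF \<alpha>(1)]] by blast
  have tS: "t \<in> ?S" using t d by simp
  note at = at_within_openin_eq[OF S tS]
  have "(cmap c \<circ> \<alpha> has_vector_derivative velocity M I \<alpha> t) (at t within I)"
    using velocity_chart[OF \<alpha>(1) t c] to_chart_at[OF p] by (simp add: c_def)
  from curve_transition[OF d(3) curve_continuous[OF \<alpha>(1)] t c(2) d(2) this]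
  have "((\<lambda>\<tau>. b \<bullet> (cmap d \<circ> \<alpha>) \<tau>) has_vector_derivative b \<bullet> transition_deriv c d (\<alpha> t) (velocity M I \<alpha> t)) (at t within I)"
    by (rule bounded_linear.has_vector_derivative[OF bounded_linear_inner_right])
  then have "((\<lambda>\<tau>. b \<bullet> (cmap d \<circ> \<alpha>) \<tau>) has_vector_derivative b \<bullet> transition_deriv c d (\<alpha> t) (velocity M I \<alpha> t)) (at t within ?S)"
    by (simp add: at)
  moreover have "b \<bullet> cmap d (\<alpha> \<tau>) = 0" if "\<tau> \<in> ?S" for \<tau>
  proof -
    have "cmap d (\<alpha> \<tau>) \<in> cmap d ` (N \<inter> cdom d)" using that \<alpha>(2) by blast
    then show ?thesis unfolding d(4) by blast
  qed
  then have "((\<lambda>\<tau>. b \<bullet> (cmap d \<circ> \<alpha>) \<tau>) has_vector_derivative 0) (at t within ?S)"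
    by (intro has_vector_derivative_transform[OF tS _ has_vector_derivative_const[of 0]]) simp
  ultimately show ?thesis
    unfolding at c_def[symmetric] using vector_derivative_unique_within[OF curve_at_neq_bot[OF \<alpha>(1) t]] by blast
qed

text \<open>The curve is the preimage under \<open>d\<close> of a line in the hyperplane, so it
  stays in \<open>N\<close>. Two further properties prepare the passage to arc length: it remains in
  one atlas chart, where its speed can be computed, and its velocity never vanishes.\<close>

lemma slice_line:
  assumes p: "p \<in> N" and s: "slice p d b" and v: "b \<bullet> transition_deriv (chart_at M p) d p v = 0"
  obtains e \<gamma> where "e > 0" "Ck_curve 2 M {-e<..<e} \<gamma>" "\<gamma> ` {-e<..<e} \<subseteq> N \<inter> cdom (chart_at M p)"
    "\<gamma> 0 = p" "velocity M {-e<..<e} \<gamma> 0 = v"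
    "\<And>t. t \<in> {-e<..<e} \<Longrightarrow> v \<noteq> 0 \<Longrightarrow> velocity M {-e<..<e} \<gamma> t \<noteq> 0"
proof -
  define c where "c = chart_at M p"
  have pt: "p \<in> topspace (pts M)" using N_topspace[OF p] .
  have c: "c \<in> atlas M" "p \<in> cdom c" using chart_at[OF pt] by (auto simp: c_def)
  have d: "is_chart (pts M) d" "p \<in> cdom d" "\<And>c. c \<in> atlas M \<Longrightarrow> compatible (pts M) c d"
    "cmap d ` (N \<inter> cdom d) = {x \<in> cmap d ` cdom d. b \<bullet> x = 0}"
    using s unfolding slice_def by blast+
  define w where "w = transition_deriv c d p v"
  have bw: "b \<bullet> w = 0" using v by (simp add: w_def c_def)
  have "cmap d p \<in> cmap d ` (N \<inter> cdom d)" using p d by blast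
  then have b0: "b \<bullet> cmap d p = 0" unfolding d(4) by blast
  define l where "l t = cmap d p + t *\<^sub>R w" for t :: real
  define \<gamma> where "\<gamma> t = cinv d (l t)" for t
  \<comment> \<open>Intersecting with the domain of \<open>c\<close> keeps the whole curve in the
    preferred chart of \<open>p\<close>.\<close>
  let ?V = "cmap d ` (cdom d \<inter> cdom c)"
  have V: "open ?V" using open_chart_overlap[OF d(1) atlas_chart[OF c(1)]] .
  have lc: "continuous_on UNIV l" unfolding l_def by (intro continuous_intros)
  have "open (l -` ?V)" using open_vimage[OF V lc] .
  moreover have "0 \<in> l -` ?V" using c d by (auto simp: l_def)
  ultimately obtain e where e: "e > 0" "ball 0 e \<subseteq> l -` ?V" using open_contains_ball by metis
  let ?I = "{-e<..<e}"
  have lV: "l t \<in> ?V" if "t \<in> ?I" for t using e(2) that by (auto simp: subset_iff)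
  have lim: "l t \<in> cmap d ` cdom d" if "t \<in> ?I" for t using lV[OF that] by blast
  have \<gamma>d: "\<gamma> t \<in> cdom d" "cmap d (\<gamma> t) = l t" if "t \<in> ?I" for t
    using cinv_in[OF lim[OF that]] cmap_cinv[OF lim[OF that]] by (auto simp: \<gamma>_def)
  have \<gamma>c: "\<gamma> t \<in> cdom c" if "t \<in> ?I" for t
    using lV[OF that] cinv_cmap[OF d(1)] by (auto simp: \<gamma>_def)
  have \<gamma>N: "\<gamma> t \<in> N" if "t \<in> ?I" for t
  proof -
    have "l t \<in> {x \<in> cmap d ` cdom d. b \<bullet> x = 0}"
      using lim[OF that] by (simp add: l_def inner_add_right b0 bw)
    then have "l t \<in> cmap d ` (N \<inter> cdom d)" unfolding d(4) .
    then show ?thesis using cinv_cmap[OF d(1)] by (auto simp: \<gamma>_def)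
  qed
  have "continuous_map (top_of_set ?I) (top_of_set (cmap d ` cdom d)) l"
    using continuous_on_subset[OF lc] lim by (auto simp: continuous_map_in_subtopology)
  then have "continuous_map (top_of_set ?I) (pts M) (cinv d \<circ> l)"
    by (rule continuous_map_compose[OF _ continuous_map_cinv[OF d(1)]])
  moreover have "\<gamma> = cinv d \<circ> l" by (simp add: \<gamma>_def fun_eq_iff)
  ultimately have cont: "continuous_map (top_of_set ?I) (pts M) \<gamma>" by simp
  have accI: "accessible S" if "openin (top_of_set ?I) S" for S
    using openin_interval_accessible[OF _ _ that] e(1) by (simp add: is_interval_oo)
  have l2: "Ck_on k l S" if "accessible S" for k S
  \<comment> \<open>Going one class higher lets \<open>Ck_on_SucI\<close> with the constant
    derivative cover every \<open>k\<close>, including 0.\<close>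
  proof (rule Ck_on_mono[of "Suc k"])
    show "Ck_on (Suc k) l S"
      by (rule Ck_on_SucI[OF that _ Ck_on_const[OF that], of _ "\<lambda>v. v *\<^sub>R w"])
         (auto simp: l_def[abs_def] intro!: derivative_eq_intros)
  qed simp
  have curve: "Ck_curve 2 M ?I \<gamma>" unfolding Ck_curve_def
  proof (intro conjI ballI)
    show "is_interval ?I" by (simp add: is_interval_oo)
    show "interior ?I \<noteq> {}" using e(1) by simp
    show "continuous_map (top_of_set ?I) (pts M) \<gamma>" by (rule cont)
    fix c' assume c': "c' \<in> atlas M"
    let ?S = "{t \<in> ?I. \<gamma> t \<in> cdom c'}"
    have S: "openin (top_of_set ?I) ?S"
      using openin_curve_preimage[OF cont] atlas_chart[OF c'] by (auto simp: is_chart_def)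
    have tr: "Ck_on 2 (transition d c') (cmap d ` (cdom c' \<inter> cdom d))"
      using d(3)[OF c'] unfolding compatible_def Ck_compatible_def by blast
    have "l ` ?S \<subseteq> cmap d ` (cdom c' \<inter> cdom d)" using \<gamma>d by force
    from Ck_on_compose[OF accI[OF S] this tr l2[OF accI[OF S]]]
    have "Ck_on 2 (\<lambda>t. transition d c' (l t)) ?S" .
    then show "Ck_on 2 (cmap c' \<circ> \<gamma>) ?S" by (simp add: transition_def \<gamma>_def o_def)
  qed
  have curve1: "Ck_curve 1 M ?I \<gamma>" using Ck_curve_mono[OF curve] by simp
  \<comment> \<open>In the coordinates of \<open>d\<close> the velocity is the constant
    \<open>w\<close>; being the image of \<open>w\<close> under an invertible differential, it is
    nonzero everywhere once \<open>v\<close> is nonzero.\<close>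
  have vel: "velocity M ?I \<gamma> t = transition_deriv d (chart_at M (\<gamma> t)) (\<gamma> t) w" if t: "t \<in> ?I" for t
  proof (rule velocity_eqI[OF curve1 t])
    have q: "\<gamma> t \<in> topspace (pts M)" using curve_topspace[OF curve1 t] .
    have "(l has_vector_derivative w) (at t within ?I)"
      unfolding l_def by (auto intro!: derivative_eq_intros)
    then have "(cmap d \<circ> \<gamma> has_vector_derivative w) (at t within ?I)"
      by (rule has_vector_derivative_transform[OF t, rotated]) (simp add: \<gamma>d)
    from curve_transition[OF compatible_sym[OF d(3)[OF chart_at(1)[OF q]]] cont t \<gamma>d(1)[OF t] chart_at(2)[OF q] this]
    show "(cmap (chart_at M (\<gamma> t)) \<circ> \<gamma> has_vector_derivative transition_deriv d (chart_at M (\<gamma> t)) (\<gamma> t) w) (at t within ?I)" .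
  qed
  show ?thesis
  proof (rule that[of e \<gamma>])
    show g0: "\<gamma> 0 = p" using cinv_cmap[OF d(1,2)] by (simp add: \<gamma>_def l_def)
    show "\<gamma> ` ?I \<subseteq> N \<inter> cdom (chart_at M p)" using \<gamma>N \<gamma>c by (auto simp: c_def)
    show "velocity M ?I \<gamma> 0 = v"
      using vel[of 0] e(1) transition_deriv_inverse[OF d(3)[OF c(1)] c(2) d(2)] by (simp add: g0 w_def c_def)
    fix t assume t: "t \<in> ?I" and "v \<noteq> 0"
    have q: "\<gamma> t \<in> topspace (pts M)" using curve_topspace[OF curve1 t] .
    note cd = d(3)[OF c(1)] and cq = d(3)[OF chart_at(1)[OF q]]
    have "w \<noteq> 0"
      using transition_deriv_inverse[OF cd c(2) d(2), of v] \<open>v \<noteq> 0\<close> linear_0[OF transition_deriv_linear[OF compatible_sym[OF cd] d(2) c(2)]]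
      by (auto simp: w_def)
    then show "velocity M ?I \<gamma> t \<noteq> 0"
      unfolding vel[OF t]
      using transition_deriv_inverse[OF compatible_sym[OF cq] \<gamma>d(1)[OF t] chart_at(2)[OF q], of w]
        linear_0[OF transition_deriv_linear[OF cq chart_at(2)[OF q] \<gamma>d(1)[OF t]]] by auto
  qed (use e curve in auto)
qed

text \<open>Turns a set of velocities into the kernel of a linear functional: curves in
  \<open>N\<close> cannot leave the hyperplane to first order, and straight lines realize every
  direction in it.\<close>

lemma tangent_space_slice:
  assumes p: "p \<in> N" and s: "slice p d b"
  shows "tangent_space M N p = {v. b \<bullet> transition_deriv (chart_at M p) d p v = 0}"
proof (intro equalityI subsetI CollectI)
  fix v assume "v \<in> tangent_space M N p"
  then obtain I \<gamma> t where g: "Ck_curve 1 M I \<gamma>" "\<gamma> ` I \<subseteq> N" "t \<in> interior I" "\<gamma> t = p" "v = velocity M I \<gamma> t"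
    unfolding tangent_space_def by blast
  have "t \<in> I" using g(3) interior_subset by blast
  then show "b \<bullet> transition_deriv (chart_at M p) d p v = 0" using velocity_in_slice[OF g(1,2), of t d b] g(4,5) s by simp
next
  fix v assume "v \<in> {v. b \<bullet> transition_deriv (chart_at M p) d p v = 0}"
  then have "b \<bullet> transition_deriv (chart_at M p) d p v = 0" by simp
  from slice_line[OF p s this] obtain e \<gamma> where g: "e > 0" "Ck_curve 2 M {-e<..<e} \<gamma>"
    "\<gamma> ` {-e<..<e} \<subseteq> N \<inter> cdom (chart_at M p)" "\<gamma> 0 = p" "velocity M {-e<..<e} \<gamma> 0 = v" by metis
  have "Ck_curve 1 M {-e<..<e} \<gamma>" using Ck_curve_mono[OF g(2)] by simp
  moreover have "0 \<in> interior {-e<..<e}" using g(1) by simp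
  moreover have "\<gamma> ` {-e<..<e} \<subseteq> N" using g(3) by blast
  ultimately show "v \<in> tangent_space M N p" unfolding tangent_space_def using g(4,5) by blast
qed

lemma slice_linear: "p \<in> N \<Longrightarrow> slice p d b \<Longrightarrow> linear (transition_deriv (chart_at M p) d p)"
  unfolding slice_def by (rule transition_deriv_linear[of "pts M"]) (use chart_at N_topspace in blast)+

lemma subspace_tangent_space: "subspace (tangent_space M N p)" if p: "p \<in> N"
proof -
  obtain d b where s: "slice p d b" using slice_exists[OF p] by blast
  note l = slice_linear[OF p s]
  show ?thesis unfolding tangent_space_slice[OF p s]
    by (auto simp: subspace_def linear_0[OF l] linear_add[OF l] linear_scale[OF l] inner_add_right)
qed

lemma dim_tangent_space: "dim (tangent_space M N p) = DIM('e) - 1" if p: "p \<in> N"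
proof -
  obtain d b where s: "slice p d b" using slice_exists[OF p] by blast
  note l = slice_linear[OF p s]
  define c where "c = chart_at M p"
  have c: "c \<in> atlas M" "p \<in> cdom c" using chart_at[OF N_topspace[OF p]] by (auto simp: c_def)
  have d: "compatible (pts M) d c" "p \<in> cdom d" "b \<noteq> 0"
    using s c compatible_sym unfolding slice_def by blast+
  \<comment> \<open>The adjoint rewrites the functional as an inner product with \<open>a\<close>,
    so the tangent space is a hyperplane in the standard form. That \<open>a\<close> is nonzero is
    tested on the preimage of \<open>b\<close> under the differential.\<close>
  define a where "a = adjoint (transition_deriv c d p) b"
  have a: "b \<bullet> transition_deriv c d p v = a \<bullet> v" for v
    using adjoint_works[OF l, of v b] by (simp add: a_def c_def inner_commute)
  have "a \<noteq> 0"
    using a[of "transition_deriv d c p b"] transition_deriv_inverse[OF d(1,2) c(2), of b] d(3) by auto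
  then show ?thesis
    unfolding tangent_space_slice[OF p s] c_def[symmetric] a by (rule dim_hyperplane)
qed

text \<open>Not immediate from the definition, which admits only interior parameters: at an endpoint
  of \<open>I\<close> tangency comes from the linear description of the tangent space.\<close>

lemma velocity_tangent:
  assumes \<alpha>: "Ck_curve 1 M I \<alpha>" "\<alpha> ` I \<subseteq> N" and t: "t \<in> I"
  shows "velocity M I \<alpha> t \<in> tangent_space M N (\<alpha> t)"
proof -
  have p: "\<alpha> t \<in> N" using \<alpha> t by blast
  obtain d b where s: "slice (\<alpha> t) d b" using slice_exists[OF p] by blast
  show ?thesis unfolding tangent_space_slice[OF p s] using velocity_in_slice[OF \<alpha> t s] by simp
qed

lemma cov_deriv_normal:
  assumes \<alpha>: "Ck_curve 1 M I \<alpha>" "\<alpha> ` I \<subseteq> N" and t: "t \<in> I"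
  shows "cov_deriv M I \<alpha> (\<xi> \<circ> \<alpha>) t = - shape_operator M N \<xi> (\<alpha> t) (velocity M I \<alpha> t)"
proof -
  have p: "\<alpha> t \<in> N" using \<alpha> t by blast
  obtain F where F: "local_extension M N \<xi> (\<alpha> t) F" using normal_extension[OF p] by blast
  show ?thesis
    using cov_deriv_eq_nabla[OF \<alpha> t F] shape_operator_eq[OF p F velocity_tangent[OF \<alpha> t]] by simp
qed

lemma umbilical_scalar:
  assumes p: "p \<in> N" and u: "umbilical_at M N \<xi> p"
  shows "\<exists>l. \<forall>v\<in>tangent_space M N p. shape_operator M N \<xi> p v = l *\<^sub>R v"
proof -
  let ?T = "tangent_space M N p"
  note T = subspace_tangent_space[OF p]
  interpret inner_form "riem M p" by (rule inner_form_riem[OF N_topspace[OF p]])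
  obtain F where F: "local_extension M N \<xi> p F" using normal_extension[OF p] by blast
  note S = shape_operator_eq[OF p F]
  \<comment> \<open>\<open>shape_operator\<close> is controlled only on tangent vectors, whereas
    this map is linear on the whole space and agrees with it there.\<close>
  define L where "L v = - nabla M F p v" for v
  have L: "linear L" unfolding L_def using linear_compose_neg[OF nabla_linear[OF p F]] by simp
  have "\<exists>l. L v = l *\<^sub>R v" if v: "v \<in> ?T" for v
  proof (cases "v = 0")
    case True
    then show ?thesis using linear_0[OF L] by simp
  next
    case False
    \<comment> \<open>Umbilicity speaks of unit vectors; rescaling by the length carries the
      eigenvector property to all tangent vectors.\<close>
    define r where "r = sqrt (riem M p v v)"
    have r: "r > 0" "r * r = riem M p v v" using pos[OF False] by (auto simp: r_def)
    have "(1 / r) *\<^sub>R v \<in> ?T" using subspace_scale[OF T v] .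
    moreover have "riem M p ((1 / r) *\<^sub>R v) ((1 / r) *\<^sub>R v) = 1"
      using r pos[OF False] by (simp add: form_simps field_simps)
    ultimately obtain l where "L ((1 / r) *\<^sub>R v) = l *\<^sub>R ((1 / r) *\<^sub>R v)"
      using u S unfolding umbilical_at_def L_def by metis
    then have "(1 / r) *\<^sub>R L v = (1 / r) *\<^sub>R (l *\<^sub>R v)"
      by (simp only: linear_scale[OF L] scaleR_left_commute[of l "1 / r"])
    then have "L v = l *\<^sub>R v" unfolding scaleR_cancel_left using r by simp
    then show ?thesis by blast
  qed
  from eigenvectors_imp_scalar[OF L T this] show ?thesis using S by (simp add: L_def)
qed

text \<open>The only nontrivial principal space is the full tangent space, so the weighted sum is
  its dimension times \<open>l\<close>. The nonzero \<open>v\<close> makes \<open>l\<close> an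
  actual eigenvalue and keeps the divisor from being 0.\<close>

lemma mean_curvature_eq:
  assumes p: "p \<in> N" and S: "\<And>v. v \<in> tangent_space M N p \<Longrightarrow> shape_operator M N \<xi> p v = l *\<^sub>R v"
    and v: "v \<in> tangent_space M N p" "v \<noteq> 0"
  shows "mean_curvature M N \<xi> p = l"
proof -
  let ?T = "tangent_space M N p"
  have "principal_space M N \<xi> p k = (if k = l then ?T else {0})" for k
    unfolding principal_space_def using S subspace_0[OF subspace_tangent_space[OF p]] by auto
  then have ps: "principal_space M N \<xi> p l = ?T" and "principal_curvatures M N \<xi> p = {l}"
    unfolding principal_curvatures_def using v by (auto split: if_splits)
  moreover have "dim ?T \<noteq> 0" using v by auto
  ultimately show ?thesis unfolding mean_curvature_def using dim_tangent_space[OF p] by simp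
qed

end

section \<open>Arc-length curves in a hypersurface\<close>

lemma Ck_on_sqrt: "Ck_on 1 sqrt {0<..}"
  unfolding One_nat_def
proof (rule Ck_on_SucI[where D = "\<lambda>x v. inverse (sqrt x) / 2 * v"])
  show "accessible {0 :: real<..}" by (intro open_accessible) simp
  show "(sqrt has_derivative (\<lambda>v. inverse (sqrt x) / 2 * v)) (at x within {0<..})"
    if "x \<in> {0<..}" for x
    using has_field_derivative_at_within[OF DERIV_real_sqrt[of x]] that
    by (simp add: has_field_derivative_def del: times_divide_eq_left)
  show "Ck_on 0 (\<lambda>x. inverse (sqrt x) / 2 * v) {0<..}" for v
    by (auto intro!: continuous_intros)
qed

lemma Ck_on_inverse: "Ck_on 1 (inverse :: real \<Rightarrow> real) {0<..}"
  unfolding One_nat_def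
proof (rule Ck_on_SucI[where D = "\<lambda>x v. - (inverse x * v * inverse x)"])
  show "accessible {0 :: real<..}" by (intro open_accessible) simp
  show "(inverse has_derivative (\<lambda>v. - (inverse x * v * inverse x))) (at x within {0<..})"
    if "x \<in> {0<..}" for x :: real
    using has_derivative_inverse'[of x] that by auto
  show "Ck_on 0 (\<lambda>x. - (inverse x * v * inverse x)) {0<..}" for v :: real
    by (auto intro!: continuous_intros)
qed

text \<open>Here \<open>q\<close> is the speed. The arc-length function \<open>\<sigma>\<close> is
  its antiderivative, and \<open>\<tau>\<close> is the inverse of \<open>\<sigma>\<close>.\<close>

lemma arclength_parameter:
  fixes q :: "real \<Rightarrow> real"
  assumes e: "e > 0" and q: "Ck_on 1 q {-e<..<e}" and q_pos: "\<And>t. t \<in> {-e<..<e} \<Longrightarrow> q t > 0"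
  obtains a b \<tau> where "a < 0" "0 < b" "\<tau> 0 = 0" "\<tau> ` {a<..<b} \<subseteq> {-e<..<e}"
    "Ck_on 2 \<tau> {a<..<b}"
    "\<And>s. s \<in> {a<..<b} \<Longrightarrow> (\<tau> has_real_derivative inverse (q (\<tau> s))) (at s)"
proof -
  \<comment> \<open>Any compact subinterval around 0 would do. Compactness gives the antiderivative
    of \<open>q\<close> and the continuity of the inverse of \<open>\<sigma>\<close>.\<close>
  define h where "h = e / 2"
  have h: "0 < h" "h < e" using e by (auto simp: h_def)
  have qc: "continuous_on {-e<..<e} q" using q Ck_on_mono[OF q, of 0] by simp
  have "continuous_on {-h..h} q" by (rule continuous_on_subset[OF qc]) (use h in auto)
  then obtain \<sigma>0 where \<sigma>0: "\<And>x. x \<in> {-h..h} \<Longrightarrow> (\<sigma>0 has_vector_derivative q x) (at x within {-h..h})"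
    using antiderivative_continuous by blast
  define \<sigma> where "\<sigma> x = \<sigma>0 x - \<sigma>0 0" for x
  have \<sigma>w: "(\<sigma> has_real_derivative q x) (at x within {-h..h})" if "x \<in> {-h..h}" for x
    unfolding \<sigma>_def using \<sigma>0[OF that]
    by (auto simp: has_real_derivative_iff_has_vector_derivative intro!: derivative_eq_intros)
  have \<sigma>c: "continuous_on {-h..h} \<sigma>"
    using \<sigma>w by (meson DERIV_continuous continuous_on_eq_continuous_within)
  have \<sigma>d: "(\<sigma> has_real_derivative q x) (at x)" if "x \<in> {-h<..<h}" for x
    using \<sigma>w[of x] that at_within_interior[of x "{-h..h}"] by auto
  have mono: "\<sigma> x < \<sigma> y" if "-h \<le> x" "x < y" "y \<le> h" for x y
  proof (rule DERIV_pos_imp_increasing_open[OF that(2)])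
    show "\<exists>z. (\<sigma> has_real_derivative z) (at u) \<and> 0 < z" if "x < u" "u < y" for u
      using \<sigma>d[of u] q_pos[of u] that \<open>-h \<le> x\<close> \<open>y \<le> h\<close> h by auto
    show "continuous_on {x..y} \<sigma>" by (rule continuous_on_subset[OF \<sigma>c]) (use that in auto)
  qed
  have \<sigma>_0: "\<sigma> 0 = 0" by (simp add: \<sigma>_def)
  have inj: "inj_on \<sigma> {-h..h}"
    by (rule linorder_inj_onI) (use mono in force)+
  define \<tau> where "\<tau> = inv_into {-h..h} \<sigma>"
  have \<tau>\<sigma>: "\<tau> (\<sigma> x) = x" if "x \<in> {-h..h}" for x using inj that by (simp add: \<tau>_def)
  define a b where "a = \<sigma> (-h)" and "b = \<sigma> h"
  have ab: "a < 0" "0 < b" using mono[of "-h" 0] mono[of 0 h] h by (auto simp: a_def b_def \<sigma>_0)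
  have img: "{a..b} \<subseteq> \<sigma> ` {-h..h}"
    using IVT'[of \<sigma> "-h" _ h] \<sigma>c h by (fastforce simp: a_def b_def)
  have \<sigma>\<tau>: "\<sigma> (\<tau> s) = s" "\<tau> s \<in> {-h..h}" if "s \<in> {a..b}" for s
  proof -
    have "s \<in> \<sigma> ` {-h..h}" using img that by blast
    from f_inv_into_f[OF this] inv_into_into[OF this] show "\<sigma> (\<tau> s) = s" "\<tau> s \<in> {-h..h}"
      by (simp_all add: \<tau>_def)
  qed
  have \<tau>in: "\<tau> s \<in> {-h<..<h}" if "s \<in> {a<..<b}" for s
  proof -
    have "\<tau> s \<noteq> h" "\<tau> s \<noteq> -h" using \<sigma>\<tau>(1)[of s] that by (auto simp: a_def b_def)
    then show ?thesis using \<sigma>\<tau>(2)[of s] that by auto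
  qed
  have "continuous_on (\<sigma> ` {-h..h}) \<tau>"
    by (rule continuous_on_inv[OF \<sigma>c]) (auto simp: \<tau>\<sigma>)
  then have \<tau>c: "continuous_on {a<..<b} \<tau>"
    by (rule continuous_on_subset) (use img in \<open>auto simp: greaterThanLessThan_subseteq_atLeastAtMost_iff\<close>)
  have \<tau>d: "(\<tau> has_real_derivative inverse (q (\<tau> s))) (at s)" if s: "s \<in> {a<..<b}" for s
  proof (rule DERIV_inverse_function[where f = \<sigma> and a = a and b = b])
    show "(\<sigma> has_real_derivative q (\<tau> s)) (at (\<tau> s))" using \<sigma>d[OF \<tau>in[OF s]] .
    show "q (\<tau> s) \<noteq> 0" using q_pos[of "\<tau> s"] \<tau>in[OF s] h by auto
    show "isCont \<tau> s" using \<tau>c s by (simp add: continuous_on_eq_continuous_at)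
  qed (use s \<sigma>\<tau> in auto)
  have acc: "accessible {a<..<b}" by (intro open_accessible) simp
  have acce: "accessible {-e<..<e}" by (intro open_accessible) simp
  have sub: "\<tau> ` {a<..<b} \<subseteq> {-e<..<e}" using \<tau>in h by fastforce
  have iq: "Ck_on 1 (\<lambda>t. inverse (q t)) {-e<..<e}"
    by (rule Ck_on_compose[OF acce _ Ck_on_inverse q]) (use q_pos in auto)
  have \<tau>D: "(\<tau> has_derivative (\<lambda>v. inverse (q (\<tau> s)) * v)) (at s within {a<..<b})" if "s \<in> {a<..<b}" for s
    using has_field_derivative_at_within[OF \<tau>d[OF that]]
    by (simp add: has_field_derivative_def)
  \<comment> \<open>Bootstrapping through \<open>\<tau>' = 1 / q(\<tau>)\<close>: if
    \<open>\<tau>\<close> is C^k with \<open>k\<close> at most 1, so is its derivative, because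
    \<open>q\<close> is C^1. Two rounds lead from continuity to class C^2.\<close>
  have step: "Ck_on (Suc k) \<tau> {a<..<b}" if "Ck_on k \<tau> {a<..<b}" "k \<le> 1" for k
  proof (rule Ck_on_SucI[OF acc \<tau>D])
    have "Ck_on k (\<lambda>s. inverse (q (\<tau> s))) {a<..<b}"
      by (rule Ck_on_compose[OF acc sub Ck_on_mono[OF iq that(2)] that(1)])
    then show "Ck_on k (\<lambda>s. inverse (q (\<tau> s)) * v) {a<..<b}" for v
      by (rule Ck_on_mult[OF acc _ Ck_on_const[OF acc]])
  qed
  have "Ck_on 2 \<tau> {a<..<b}" using step[OF step[of 0]] \<tau>c by (simp add: numeral_2_eq_2)
  moreover have "\<tau> 0 = 0" using \<tau>\<sigma>[of 0] \<sigma>_0 h by simp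
  ultimately show ?thesis using that ab sub \<tau>d by blast
qed

context riem_mfd
begin

lemma speed_C1:
  assumes \<gamma>: "Ck_curve 2 M I \<gamma>" and c: "c \<in> atlas M" "\<gamma> ` I \<subseteq> cdom c"
  shows "Ck_on 1 (\<lambda>t. riem M (\<gamma> t) (velocity M I \<gamma> t) (velocity M I \<gamma> t)) I"
proof -
  have \<gamma>1: "Ck_curve 1 M I \<gamma>" using Ck_curve_mono[OF \<gamma>] by simp
  have acc: "accessible I"
    using \<gamma> openin_interval_accessible[of I I] unfolding Ck_curve_def by simp
  have II: "{t \<in> I. \<gamma> t \<in> cdom c} = I" using c by blast
  let ?x = "cmap c \<circ> \<gamma>"
  \<comment> \<open>As a function of \<open>t\<close>, \<open>velocity\<close> itself need not even
    be continuous, since its reference chart may jump. Its components in the fixed chart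
    \<open>c\<close> are the derivative of a C^2 map.\<close>
  define y where "y t = to_chart M c (\<gamma> t) (velocity M I \<gamma> t)" for t
  have x: "Ck_on 2 ?x I" using \<gamma> c(1) unfolding Ck_curve_def by (metis II)
  have "Ck_on 1 (\<lambda>t. frechet_derivative ?x (at t within I) 1) I"
    using x unfolding numeral_2_eq_2 Ck_on.simps(2)[of "Suc 0"] One_nat_def by blast
  then have y: "Ck_on 1 y I"
  proof (rule Ck_on_cong[rotated])
    fix t assume t: "t \<in> I"
    then have "\<gamma> t \<in> cdom c" using c by blast
    from velocity_chart[OF \<gamma>1 t c(1) this]
    have "(?x has_derivative (\<lambda>h. h *\<^sub>R y t)) (at t within I)"
      by (simp add: has_vector_derivative_def y_def)
    from accessible_frechet_derivative[OF acc t this]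
    show "frechet_derivative ?x (at t within I) 1 = y t" by simp
  qed
  have g: "Ck_on 1 (\<lambda>t. riem_in M c (?x t) u v) I" for u v
  proof (rule Ck_on_compose[OF acc, where f = "\<lambda>x. riem_in M c x u v" and T = "cmap c ` cdom c"])
    show "?x ` I \<subseteq> cmap c ` cdom c" using c by auto
    have "Ck_on 2 (\<lambda>x. riem_in M c x u v) (cmap c ` cdom c)"
      using mfd c(1) unfolding riemannian_manifold_def by blast
    then show "Ck_on 1 (\<lambda>x. riem_in M c x u v) (cmap c ` cdom c)" by (rule Ck_on_mono) simp
    show "Ck_on 1 ?x I" by (rule Ck_on_mono[OF x]) simp
  qed
  have "Ck_on 1 (\<lambda>t. \<Sum>i\<in>Basis. \<Sum>j\<in>Basis. (y t \<bullet> i) * (y t \<bullet> j) * riem_in M c (?x t) i j) I"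
    by (rule Ck_on_sum[OF acc], rule Ck_on_sum[OF acc], rule Ck_on_mult[OF acc _ g],
        rule Ck_on_mult[OF acc]; rule Ck_on_linear[OF acc bounded_linear_inner_left y])
  then show ?thesis
  proof (rule Ck_on_cong[rotated])
    fix t assume "t \<in> I"
    then have ct: "\<gamma> t \<in> cdom c" using c by blast
    then have "inner_form (riem_in M c (?x t))"
      using metric_field.form[OF metric_field_riem_in[OF c(1)]] by simp
    from bilinear_expand[OF inner_form.bil[OF this], of "y t" "y t"]
    show "(\<Sum>i\<in>Basis. \<Sum>j\<in>Basis. (y t \<bullet> i) * (y t \<bullet> j) * riem_in M c (?x t) i j) =
        riem M (\<gamma> t) (velocity M I \<gamma> t) (velocity M I \<gamma> t)"
      using riem_in_to_chart[OF c(1) ct] by (simp add: y_def)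
  qed
qed

lemma reparametrization:
  fixes J :: "real set"
  assumes \<gamma>: "Ck_curve 2 M I \<gamma>" and J: "open J" "is_interval J" "J \<noteq> {}" "\<tau> ` J \<subseteq> I"
    and \<tau>: "Ck_on 2 \<tau> J" "\<And>s. s \<in> J \<Longrightarrow> (\<tau> has_real_derivative r s) (at s)"
  shows "Ck_curve 2 M J (\<gamma> \<circ> \<tau>)"
    and "\<And>s. s \<in> J \<Longrightarrow> velocity M J (\<gamma> \<circ> \<tau>) s = r s *\<^sub>R velocity M I \<gamma> (\<tau> s)"
proof -
  have \<gamma>1: "Ck_curve 1 M I \<gamma>" using Ck_curve_mono[OF \<gamma>] by simp
  have iJ: "interior J \<noteq> {}" using J by (simp add: interior_open)
  have "continuous_on J \<tau>" using Ck_on_mono[OF \<tau>(1), of 0] by simp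
  then have "continuous_map (top_of_set J) (top_of_set I) \<tau>"
    using J(4) by (auto simp: continuous_map_in_subtopology)
  then have cont: "continuous_map (top_of_set J) (pts M) (\<gamma> \<circ> \<tau>)"
    by (rule continuous_map_compose[OF _ curve_continuous[OF \<gamma>1]])
  show curve: "Ck_curve 2 M J (\<gamma> \<circ> \<tau>)" unfolding Ck_curve_def
  proof (intro conjI ballI)
    fix c assume c: "c \<in> atlas M"
    let ?S = "{s \<in> J. (\<gamma> \<circ> \<tau>) s \<in> cdom c}" and ?T = "{t \<in> I. \<gamma> t \<in> cdom c}"
    have S: "openin (top_of_set J) ?S"
      using openin_curve_preimage[OF cont] atlas_chart[OF c] unfolding is_chart_def by blast
    have acc: "accessible ?S" by (rule openin_interval_accessible[OF J(2) iJ S])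
    have x: "Ck_on 2 (cmap c \<circ> \<gamma>) ?T" using \<gamma> c unfolding Ck_curve_def by blast
    have "Ck_on 2 (\<lambda>s. (cmap c \<circ> \<gamma>) (\<tau> s)) ?S"
      by (rule Ck_on_compose[OF acc _ x Ck_on_openin[OF S \<tau>(1)]]) (use J in auto)
    then show "Ck_on 2 (cmap c \<circ> (\<gamma> \<circ> \<tau>)) ?S" by (simp add: o_def)
  qed (use J iJ cont in auto)
  fix s assume s: "s \<in> J"
  let ?c = "chart_at M (\<gamma> (\<tau> s))"
  have t: "\<tau> s \<in> I" using J s by blast
  have p: "\<gamma> (\<tau> s) \<in> topspace (pts M)" using curve_topspace[OF \<gamma>1 t] .
  have 1: "(cmap ?c \<circ> \<gamma> has_vector_derivative velocity M I \<gamma> (\<tau> s)) (at (\<tau> s) within \<tau> ` J)"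
    using velocity_chart[OF \<gamma>1 t chart_at[OF p]] to_chart_at[OF p] has_vector_derivative_within_subset J(4)
    by fastforce
  have 2: "(\<tau> has_vector_derivative r s) (at s within J)"
    using \<tau>(2)[OF s] by (simp add: has_real_derivative_iff_has_vector_derivative has_vector_derivative_at_within)
  have "((cmap ?c \<circ> \<gamma>) \<circ> \<tau> has_vector_derivative r s *\<^sub>R velocity M I \<gamma> (\<tau> s)) (at s within J)"
    by (rule vector_diff_chain_within[OF 2 1])
  then have "(cmap (chart_at M ((\<gamma> \<circ> \<tau>) s)) \<circ> (\<gamma> \<circ> \<tau>) has_vector_derivative r s *\<^sub>R velocity M I \<gamma> (\<tau> s)) (at s within J)"
    by (simp add: o_assoc)
  then show "velocity M J (\<gamma> \<circ> \<tau>) s = r s *\<^sub>R velocity M I \<gamma> (\<tau> s)"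
    using velocity_eqI[OF Ck_curve_mono[OF curve] s] by simp
qed

end

context hypersurface_mfd
begin

lemma arclength_curve_through:
  assumes p: "p \<in> N" and v: "v \<in> tangent_space M N p" "riem M p v v = 1"
  obtains I \<alpha> s where "arclength_curve M I \<alpha>" "\<alpha> ` I \<subseteq> N" "s \<in> I" "\<alpha> s = p" "velocity M I \<alpha> s = v"
proof -
  have v0: "v \<noteq> 0" using v(2) inner_form.form_simps[OF inner_form_riem[OF N_topspace[OF p]]] by fastforce
  obtain d b where s: "slice p d b" using slice_exists[OF p] by blast
  have "b \<bullet> transition_deriv (chart_at M p) d p v = 0" using v(1) tangent_space_slice[OF p s] by blast
  from slice_line[OF p s this] obtain e \<gamma> where e: "e > 0" and \<gamma>: "Ck_curve 2 M {-e<..<e} \<gamma>"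
    "\<gamma> ` {-e<..<e} \<subseteq> N \<inter> cdom (chart_at M p)" "\<gamma> 0 = p" "velocity M {-e<..<e} \<gamma> 0 = v"
    and nz: "\<And>t. t \<in> {-e<..<e} \<Longrightarrow> velocity M {-e<..<e} \<gamma> t \<noteq> 0" using v0 by metis
  let ?I = "{-e<..<e}"
  let ?w = "velocity M ?I \<gamma>"
  define h where "h t = riem M (\<gamma> t) (?w t) (?w t)" for t
  have top: "\<gamma> t \<in> topspace (pts M)" if "t \<in> ?I" for t using \<gamma>(2) that N_topspace by blast
  have h_pos: "h t > 0" if "t \<in> ?I" for t
    unfolding h_def by (rule inner_form.pos[OF inner_form_riem[OF top[OF that]] nz[OF that]])
  have "Ck_on 1 h ?I"
    unfolding h_def by (rule speed_C1[OF \<gamma>(1) chart_at(1)[OF N_topspace[OF p]]]) (use \<gamma>(2) in blast)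
  then have q: "Ck_on 1 (\<lambda>t. sqrt (h t)) ?I"
    by (intro Ck_on_compose[OF _ _ Ck_on_sqrt] open_accessible) (use h_pos in auto)
  obtain a b \<tau> where ab: "a < 0" "0 < b" and \<tau>: "\<tau> 0 = 0" "\<tau> ` {a<..<b} \<subseteq> ?I" "Ck_on 2 \<tau> {a<..<b}"
    "\<And>s. s \<in> {a<..<b} \<Longrightarrow> (\<tau> has_real_derivative inverse (sqrt (h (\<tau> s)))) (at s)"
    using arclength_parameter[OF e q] h_pos by auto
  let ?J = "{a<..<b}"
  have J: "open ?J" "is_interval ?J" "?J \<noteq> {}" using ab by (auto simp: is_interval_oo)
  have rep1: "Ck_curve 2 M ?J (\<gamma> \<circ> \<tau>)"
    by (rule reparametrization(1)[OF \<gamma>(1) J \<tau>(2,3)]) (rule \<tau>(4))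
  have rep2: "velocity M ?J (\<gamma> \<circ> \<tau>) s = inverse (sqrt (h (\<tau> s))) *\<^sub>R ?w (\<tau> s)" if "s \<in> ?J" for s
    by (rule reparametrization(2)[OF \<gamma>(1) J \<tau>(2,3) _ that]) (rule \<tau>(4))
  have "arclength_curve M ?J (\<gamma> \<circ> \<tau>)" unfolding arclength_curve_def
  proof (intro conjI ballI rep1)
    fix s assume sJ: "s \<in> ?J"
    then have t: "\<tau> s \<in> ?I" using \<tau>(2) by blast
    interpret inner_form "riem M (\<gamma> (\<tau> s))" by (rule inner_form_riem[OF top[OF t]])
    have "sqrt (h (\<tau> s)) * sqrt (h (\<tau> s)) = h (\<tau> s)" using h_pos[OF t] by simp
    then show "riem M ((\<gamma> \<circ> \<tau>) s) (velocity M ?J (\<gamma> \<circ> \<tau>) s) (velocity M ?J (\<gamma> \<circ> \<tau>) s) = 1"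
      using h_pos[OF t] rep2[OF sJ] by (simp add: form_simps h_def field_simps)
  qed
  \<comment> \<open>The original velocity at 0 is the unit vector \<open>v\<close>, so
    \<open>h 0 = 1\<close> and the reparametrization leaves it unchanged.\<close>
  moreover have "velocity M ?J (\<gamma> \<circ> \<tau>) 0 = v"
    using rep2[of 0] ab \<tau>(1) \<gamma>(3,4) v(2) by (simp add: h_def)
  moreover have "(\<gamma> \<circ> \<tau>) ` ?J \<subseteq> N" using \<tau>(2) \<gamma>(2) by (auto simp: image_subset_iff)
  ultimately show ?thesis using that[of ?J "\<gamma> \<circ> \<tau>" 0] ab \<tau>(1) \<gamma>(3) by simp
qed

section \<open>Umbilicity and rotation minimization of the normal\<close>

lemma totally_umbilical_iff_rotation_minimizing:
  "totally_umbilical M N \<xi> \<longleftrightarrow>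
     (\<forall>I \<alpha>. arclength_curve M I \<alpha> \<and> \<alpha> ` I \<subseteq> N \<longrightarrow> rotation_minimizing M I \<alpha> (\<xi> \<circ> \<alpha>))"
proof (intro iffI allI impI)
  fix I \<alpha>
  assume u: "totally_umbilical M N \<xi>" and "arclength_curve M I \<alpha> \<and> \<alpha> ` I \<subseteq> N"
  then have \<alpha>: "Ck_curve 1 M I \<alpha>" "\<alpha> ` I \<subseteq> N"
    and unit: "\<And>s. s \<in> I \<Longrightarrow> riem M (\<alpha> s) (velocity M I \<alpha> s) (velocity M I \<alpha> s) = 1"
    using Ck_curve_mono[of 2] unfolding arclength_curve_def by auto
  have "riem M (\<alpha> s) ((\<xi> \<circ> \<alpha>) s) ((\<xi> \<circ> \<alpha>) s) = 1 \<and> riem M (\<alpha> s) ((\<xi> \<circ> \<alpha>) s) (velocity M I \<alpha> s) = 0"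
    if "s \<in> I" for s
    using normal velocity_tangent[OF \<alpha> that] \<alpha>(2) that unfolding unit_normal_field_def by fastforce
  moreover have "\<exists>l. cov_deriv M I \<alpha> (\<xi> \<circ> \<alpha>) s = l *\<^sub>R velocity M I \<alpha> s" if s: "s \<in> I" for s
  proof -
    have "umbilical_at M N \<xi> (\<alpha> s)" using u \<alpha>(2) s unfolding totally_umbilical_def by blast
    then obtain l where "shape_operator M N \<xi> (\<alpha> s) (velocity M I \<alpha> s) = l *\<^sub>R velocity M I \<alpha> s"
      using velocity_tangent[OF \<alpha> s] unit[OF s] unfolding umbilical_at_def by blast
    then have "cov_deriv M I \<alpha> (\<xi> \<circ> \<alpha>) s = (- l) *\<^sub>R velocity M I \<alpha> s"
      using cov_deriv_normal[OF \<alpha> s] by simp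
    then show ?thesis by blast
  qed
  then have "\<exists>\<mu>. \<forall>s\<in>I. cov_deriv M I \<alpha> (\<xi> \<circ> \<alpha>) s = \<mu> s *\<^sub>R velocity M I \<alpha> s" by metis
  ultimately show "rotation_minimizing M I \<alpha> (\<xi> \<circ> \<alpha>)"
    unfolding rotation_minimizing_def using normal_field_along[OF \<alpha>] by blast
next
  assume R: "\<forall>I \<alpha>. arclength_curve M I \<alpha> \<and> \<alpha> ` I \<subseteq> N \<longrightarrow> rotation_minimizing M I \<alpha> (\<xi> \<circ> \<alpha>)"
  show "totally_umbilical M N \<xi>" unfolding totally_umbilical_def umbilical_at_def
  proof (intro ballI impI)
    fix p v assume p: "p \<in> N" and v: "v \<in> tangent_space M N p" "riem M p v v = 1"
    obtain I \<alpha> s where \<alpha>: "arclength_curve M I \<alpha>" "\<alpha> ` I \<subseteq> N" "s \<in> I" "\<alpha> s = p" "velocity M I \<alpha> s = v"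
      using arclength_curve_through[OF p v] .
    have "Ck_curve 1 M I \<alpha>" using \<alpha>(1) Ck_curve_mono[of 2] unfolding arclength_curve_def by auto
    then have "cov_deriv M I \<alpha> (\<xi> \<circ> \<alpha>) s = - shape_operator M N \<xi> p v"
      using cov_deriv_normal[of I \<alpha> s] \<alpha> by simp
    moreover obtain l where "cov_deriv M I \<alpha> (\<xi> \<circ> \<alpha>) s = l *\<^sub>R v"
      using R \<alpha> unfolding rotation_minimizing_def by blast
    ultimately have "shape_operator M N \<xi> p v = (- l) *\<^sub>R v" by simp
    then show "\<exists>l. shape_operator M N \<xi> p v = l *\<^sub>R v" by blast
  qed
qed

section \<open>Expansion in a rotation minimizing frame and the mean curvature\<close>

lemma rm_frame_coefficient:
  assumes n: "rm_frame M I \<alpha> n" and m: "m = DIM('e) - 1" and p: "\<alpha> s \<in> topspace (pts M)"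
    and s: "s \<in> I" and w: "w = (\<Sum>i=1..m. a i *\<^sub>R n i s)" and i: "i \<in> {1..m}"
  shows "a i = riem M (\<alpha> s) w (n i s)"
proof -
  interpret inner_form "riem M (\<alpha> s)" by (rule inner_form_riem[OF p])
  have "riem M (\<alpha> s) w (n i s) = (\<Sum>j=1..m. a j * riem M (\<alpha> s) (n j s) (n i s))"
    unfolding w by (simp add: form_sum form_simps)
  also have "\<dots> = (\<Sum>j=1..m. if j = i then a i else 0)"
    using n i s m by (intro sum.cong) (auto simp: rm_frame_def rotation_minimizing_def)
  also have "\<dots> = a i" using i by simp
  finally show ?thesis by simp
qed

text \<open>A dimension count: a nonzero remainder \<open>z\<close> would be orthogonal to the
  velocity and to all \<open>n i\<close>, giving \<open>m + 2\<close> nonzero orthogonal vectors in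
  a space of dimension \<open>m + 1\<close>.\<close>

lemma rm_frame_expansion:
  assumes n: "rm_frame M I \<alpha> n" and m: "m = DIM('e) - 1" and p: "\<alpha> s \<in> topspace (pts M)"
    and s: "s \<in> I" and unit: "riem M (\<alpha> s) (velocity M I \<alpha> s) (velocity M I \<alpha> s) = 1"
    and w: "riem M (\<alpha> s) w (velocity M I \<alpha> s) = 0"
  shows "w = (\<Sum>i=1..m. riem M (\<alpha> s) w (n i s) *\<^sub>R n i s)"
proof (rule ccontr)
  interpret inner_form "riem M (\<alpha> s)" by (rule inner_form_riem[OF p])
  let ?g = "riem M (\<alpha> s)" and ?v = "velocity M I \<alpha> s"
  define z where "z = w - (\<Sum>i=1..m. ?g w (n i s) *\<^sub>R n i s)"
  assume "\<not> ?thesis"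
  then have z0: "z \<noteq> 0" by (simp add: z_def)
  have n1: "?g (n i s) (n i s) = 1" "?g (n i s) ?v = 0" if "i \<in> {1..m}" for i
    using n that s m by (auto simp: rm_frame_def rotation_minimizing_def)
  have nn: "?g (n i s) (n j s) = 0" if "i \<in> {1..m}" "j \<in> {1..m}" "i \<noteq> j" for i j
    using n that s m by (auto simp: rm_frame_def)
  have zn: "?g z (n i s) = 0" if i: "i \<in> {1..m}" for i
    using rm_frame_coefficient[OF n m p s refl i, of "\<lambda>i. ?g w (n i s)"] by (simp add: z_def form_simps)
  have zv: "?g z ?v = 0" by (simp add: z_def form_simps form_sum w n1)
  \<comment> \<open>Index 0 holds the velocity and \<open>Suc m\<close> the remainder, so that the
    frame keeps its own indices \<open>1..m\<close>.\<close>
  define f where "f i = (if i = 0 then ?v else if i = Suc m then z else n i s)" for i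
  have orth: "?g (f i) (f j) = 0" if "i \<le> Suc m" "j \<le> Suc m" "i < j" for i j
    using that zn[of i] zv n1(2)[of j] nn[of i j] sym[of ?v] sym[of "n i s" z]
    by (auto simp: f_def)
  have "card {0..Suc m} \<le> DIM('e)"
  proof (rule orthogonal_card_le)
    show "f i \<noteq> 0" if "i \<in> {0..Suc m}" for i
      using that z0 unit n1(1)[of i] form_simps(7)[of "f i"] by (auto simp: f_def form_simps)
    show "?g (f i) (f j) = 0" if "i \<in> {0..Suc m}" "j \<in> {0..Suc m}" "i \<noteq> j" for i j
      using that orth[of i j] orth[of j i] sym[of "f i" "f j"] by (cases "i < j") auto
  qed simp
  then show False using m DIM_positive[where 'a = 'e] by simp
qed

lemma totally_umbilical_rm_frame:
  assumes u: "totally_umbilical M N \<xi>" and m: "m = DIM('e) - 1"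
    and arc: "arclength_curve M I \<alpha>" "\<alpha> ` I \<subseteq> N"
    and n: "rm_frame M I \<alpha> n" and \<kappa>: "rm_curvatures M I \<alpha> n \<kappa>"
  shows "\<exists>a. \<forall>s\<in>I. \<xi> (\<alpha> s) = (\<Sum>i=1..m. a i s *\<^sub>R n i s)"
    and "\<And>a. \<forall>s\<in>I. \<xi> (\<alpha> s) = (\<Sum>i=1..m. a i s *\<^sub>R n i s) \<Longrightarrow>
       (\<forall>i\<in>{1..m}. a i constant_on I) \<and>
       (\<forall>s\<in>I. (\<Sum>i=1..m. a i s * \<kappa> i s) = mean_curvature M N \<xi> (\<alpha> s))"
proof -
  have \<alpha>: "Ck_curve 1 M I \<alpha>" using arc(1) Ck_curve_mono[of 2] unfolding arclength_curve_def by auto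
  have unit: "riem M (\<alpha> s) (velocity M I \<alpha> s) (velocity M I \<alpha> s) = 1" if "s \<in> I" for s
    using arc(1) that unfolding arclength_curve_def by blast
  have rm: "rotation_minimizing M I \<alpha> (\<xi> \<circ> \<alpha>)"
    using u arc totally_umbilical_iff_rotation_minimizing by blast
  have top: "\<alpha> s \<in> topspace (pts M)" if "s \<in> I" for s using curve_topspace[OF \<alpha> that] .
  have \<xi>v: "riem M (\<alpha> s) (\<xi> (\<alpha> s)) (velocity M I \<alpha> s) = 0" if "s \<in> I" for s
    using rm that unfolding rotation_minimizing_def by auto
  show "\<exists>a. \<forall>s\<in>I. \<xi> (\<alpha> s) = (\<Sum>i=1..m. a i s *\<^sub>R n i s)"
    using rm_frame_expansion[OF n m top _ unit \<xi>v]
    by (intro exI[of _ "\<lambda>i s. riem M (\<alpha> s) (\<xi> (\<alpha> s)) (n i s)"]) blast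
  fix a assume a: "\<forall>s\<in>I. \<xi> (\<alpha> s) = (\<Sum>i=1..m. a i s *\<^sub>R n i s)"
  \<comment> \<open>Whatever coefficients are given, on \<open>I\<close> they are these inner
    products, so the product rule for the metric applies to them.\<close>
  have a_eq: "a i s = riem M (\<alpha> s) (\<xi> (\<alpha> s)) (n i s)" if "i \<in> {1..m}" "s \<in> I" for i s
    by (rule rm_frame_coefficient[OF n m top[OF that(2)] that(2) _ that(1)]) (use a that in blast)
  have rmn: "rotation_minimizing M I \<alpha> (n i)" if "i \<in> {1..m}" for i
    using n that m by (simp add: rm_frame_def)
  have nf: "Ck_field_along 1 M I \<alpha> (n i)" if "i \<in> {1..m}" for i
    using rmn[OF that] unfolding rotation_minimizing_def by blast
  have const: "a i constant_on I" if i: "i \<in> {1..m}" for i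
  proof -
    have "((\<lambda>s. riem M (\<alpha> s) ((\<xi> \<circ> \<alpha>) s) (n i s)) has_vector_derivative 0) (at s within I)" if s: "s \<in> I" for s
    proof -
      interpret inner_form "riem M (\<alpha> s)" by (rule inner_form_riem[OF top[OF s]])
      have "cov_deriv M I \<alpha> (n i) s = - \<kappa> i s *\<^sub>R velocity M I \<alpha> s"
        using \<kappa> i s m unfolding rm_curvatures_def by blast
      moreover obtain l where "cov_deriv M I \<alpha> (\<xi> \<circ> \<alpha>) s = l *\<^sub>R velocity M I \<alpha> s"
        using rm s unfolding rotation_minimizing_def by blast
      moreover have "riem M (\<alpha> s) (velocity M I \<alpha> s) (n i s) = 0"
        using rmn[OF i] s sym unfolding rotation_minimizing_def by metis
      ultimately show ?thesis
        using riem_has_derivative[OF \<alpha> normal_field_along[OF \<alpha> arc(2)] nf[OF i] s] \<xi>v[OF s]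
        by (simp add: form_simps)
    qed
    then have "(a i has_derivative (\<lambda>h. 0)) (at s within I)" if "s \<in> I" for s
      using that by (intro has_derivative_transform[OF that a_eq[OF i]])
        (auto simp: has_vector_derivative_def)
    moreover have "convex I" using \<alpha> is_interval_convex unfolding Ck_curve_def by blast
    ultimately have "\<exists>c. \<forall>s\<in>I. a i s = c" using has_derivative_zero_constant by metis
    then show ?thesis unfolding constant_on_def by blast
  qed
  moreover have "(\<Sum>i=1..m. a i s * \<kappa> i s) = mean_curvature M N \<xi> (\<alpha> s)" if s: "s \<in> I" for s
  proof -
    let ?v = "velocity M I \<alpha> s"
    have p: "\<alpha> s \<in> N" using arc s by blast
    interpret inner_form "riem M (\<alpha> s)" by (rule inner_form_riem[OF top[OF s]])
    have v: "?v \<noteq> 0" using unit[OF s] by (auto simp: form_simps)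
    note vT = velocity_tangent[OF \<alpha> arc(2) s]
    obtain l where l: "\<And>v. v \<in> tangent_space M N (\<alpha> s) \<Longrightarrow> shape_operator M N \<xi> (\<alpha> s) v = l *\<^sub>R v"
      using umbilical_scalar[OF p] u p unfolding totally_umbilical_def by blast
    \<comment> \<open>Constancy allows the coefficients to be frozen at the parameter
      \<open>s\<close> for all \<open>t\<close>, as \<open>cov_deriv_sum\<close> requires.\<close>
    have "(\<xi> \<circ> \<alpha>) t = (\<Sum>i=1..m. a i s *\<^sub>R n i t)" if t: "t \<in> I" for t
    proof -
      have "a i t = a i s" if "i \<in> {1..m}" for i using const[OF that] s t unfolding constant_on_def by metis
      then show ?thesis using a t by simp
    qed
    from cov_deriv_sum[OF \<alpha> nf s this]
    have "cov_deriv M I \<alpha> (\<xi> \<circ> \<alpha>) s = (\<Sum>i=1..m. a i s *\<^sub>R cov_deriv M I \<alpha> (n i) s)" by blast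
    also have "\<dots> = (\<Sum>i=1..m. - (a i s * \<kappa> i s) *\<^sub>R ?v)"
      using \<kappa> s m unfolding rm_curvatures_def by (intro sum.cong) auto
    also have "\<dots> = - (\<Sum>i=1..m. a i s * \<kappa> i s) *\<^sub>R ?v"
      by (simp add: scaleR_sum_left sum_negf)
    finally have "l *\<^sub>R ?v = (\<Sum>i=1..m. a i s * \<kappa> i s) *\<^sub>R ?v"
      using cov_deriv_normal[OF \<alpha> arc(2) s] l[OF vT] by simp
    then have "l = (\<Sum>i=1..m. a i s * \<kappa> i s)" using v by simp
    then show ?thesis using mean_curvature_eq[OF p l vT v] by simp
  qed
  ultimately show "(\<forall>i\<in>{1..m}. a i constant_on I) \<and>
       (\<forall>s\<in>I. (\<Sum>i=1..m. a i s * \<kappa> i s) = mean_curvature M N \<xi> (\<alpha> s))" by blast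
qed

end

theorem theorem1:
  fixes M :: "('a, 'e::euclidean_space) riemannian"
    and N :: "'a set" and \<xi> :: "'a \<Rightarrow> 'e" and m :: nat
  assumes "riemannian_manifold M" and "DIM('e) = m + 1"
    and "hypersurface M N" and "unit_normal_field M N \<xi>"
  shows "(totally_umbilical M N \<xi> \<longleftrightarrow>
       (\<forall>I \<alpha>. arclength_curve M I \<alpha> \<and> \<alpha> ` I \<subseteq> N \<longrightarrow> rotation_minimizing M I \<alpha> (\<xi> \<circ> \<alpha>))) \<and>
     (totally_umbilical M N \<xi> \<longrightarrow>
       (\<forall>I \<alpha> n \<kappa>. arclength_curve M I \<alpha> \<and> \<alpha> ` I \<subseteq> N \<and>
          rm_frame M I \<alpha> n \<and> rm_curvatures M I \<alpha> n \<kappa> \<longrightarrow>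
          (\<exists>a. \<forall>s\<in>I. \<xi> (\<alpha> s) = (\<Sum>i=1..m. a i s *\<^sub>R n i s)) \<and>
          (\<forall>a. (\<forall>s\<in>I. \<xi> (\<alpha> s) = (\<Sum>i=1..m. a i s *\<^sub>R n i s)) \<longrightarrow>
             (\<forall>i\<in>{1..m}. a i constant_on I) \<and>
             (\<forall>s\<in>I. (\<Sum>i=1..m. a i s * \<kappa> i s) = mean_curvature M N \<xi> (\<alpha> s)))))"
proof -
  interpret hypersurface_mfd M N \<xi>
    using assms(1,3,4) by unfold_locales
  have m: "m = DIM('e) - 1" using assms(2) by simp
  show ?thesis
  proof (intro conjI impI allI totally_umbilical_iff_rotation_minimizing)
    fix I \<alpha> n \<kappa> assume u: "totally_umbilical M N \<xi>" and
      A: "arclength_curve M I \<alpha> \<and> \<alpha> ` I \<subseteq> N \<and> rm_frame M I \<alpha> n \<and> rm_curvatures M I \<alpha> n \<kappa>"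
    then have B: "arclength_curve M I \<alpha>" "\<alpha> ` I \<subseteq> N" "rm_frame M I \<alpha> n" "rm_curvatures M I \<alpha> n \<kappa>"
      by blast+
    note R = totally_umbilical_rm_frame[OF u m B]
    show "\<exists>a. \<forall>s\<in>I. \<xi> (\<alpha> s) = (\<Sum>i=1..m. a i s *\<^sub>R n i s)" by (rule R(1))
    fix a assume a: "\<forall>s\<in>I. \<xi> (\<alpha> s) = (\<Sum>i=1..m. a i s *\<^sub>R n i s)"
    show "\<forall>i\<in>{1..m}. a i constant_on I" using R(2)[OF a] by (rule conjunct1)
    show "\<forall>s\<in>I. (\<Sum>i=1..m. a i s * \<kappa> i s) = mean_curvature M N \<xi> (\<alpha> s)"
      using R(2)[OF a] by (rule conjunct2)
  qed
qed

end
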